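(* (Confluence of $\lambda LL$.) Let $M,M',M''$ be (well-typed) terms of $\lambda LL$ with $M\rightarrow^* M'$ and $M\rightarrow^* M''$, where $\rightarrow^*$ is the reflexive-transitive closure of $\beta$-reduction $\rightarrow$. Then there is a term $N$ such that $M'\rightarrow^* N$ and $M''\rightarrow^* N$.
   Context: **Calculus $\lambda LL$.** Fix function symbols $\underline f$ with arities $n\ge 1$, each denoting a differentiable $f:\mathbb R^n\to\mathbb R$. Types: $A,B::=\mathbb R\mid A\multimap B\mid 1\mid A\otimes B\mid\top\mid A\& B\mid {!A}$. Each variable has a type fixed once and for all. Patterns: $p,q::=x\mid {!x}\mid ()\mid (p,q)\mid\langle p,q\rangle$, with no variable occurring twice; if $x$ has type $A$ then pattern $x$ has type $A$ and pattern $!x$ has type $!A$; $()$ has type $1$; $(p,q)$ has type $A\otimes B$ and $\langle p,q\rangle$ type $A\& B$ when $p:A$, $q:B$. Patterns $!x$ are called exponential. An environment is a finite set of typed patterns with pairwise disjoint variables; $!\Gamma$ denotes an environment all of whose patterns are exponential; the comma is union of environments having no variable in common. Terms (up to $\alpha$-equivalence): $M,N::=x\mid {!M}\mid\lambda p.M\mid MN\mid ()\mid (M,N)\mid\langle\rangle\mid\langle M,N\rangle\mid\underline r\ (r\in\mathbb R)\mid\underline f\mid\dot+\mid\dot*$. "Term" means well-typed term. Typing rules: - $x:A\vdash x:A$; $\;!x:{!A}\vdash x:A$; - from $!\Gamma\vdash M:A$ infer $!\Gamma\vdash {!M}:{!A}$; from $\Delta\vdash M:B$ infer $!x:{!A},\Delta\vdash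 M:B$; - from $p:A,\Delta\vdash M:B$ infer $\Delta\vdash\lambda p.M:A\multimap B$; - from $!\Gamma_1,\Delta_1\vdash M:A\multimap B$ and $!\Gamma_2,\Delta_2\vdash N:A$ infer $!\Gamma_1\cup{!\Gamma_2},\Delta_1,\Delta_2\vdash MN:B$; - $\vdash ():1$; from $\Delta\vdash M:B$ infer $():1,\Delta\vdash M:B$; - from $!\Gamma_1,\Delta_1\vdash M:A$ and $!\Gamma_2,\Delta_2\vdash N:B$ infer $!\Gamma_1\cup{!\Gamma_2},\Delta_1,\Delta_2\vdash(M,N):A\otimes B$; from $p:A,q:B,\Delta\vdash M:C$ infer $(p,q):A\otimes B,\Delta\vdash M:C$; - from $\Delta\vdash M_1:A_1$ and $\Delta\vdash M_2:A_2$ infer $\Delta\vdash\langle M_1,M_2\rangle:A_1\& A_2$; for $i\in\{1,2\}$, from $p_i:A_i,\Delta\vdash M:B$ infer $\langle p_1,p_2\rangle:A_1\& A_2,\Delta\vdash M:B$; $\Delta\vdash\langle\rangle:\top$ for any $\Delta$; - $\vdash\underline r:\mathbb R$; $\Delta\vdash\underline 0:\mathbb R$ for any $\Delta$; $\vdash\underline f:({!\mathbb R}\otimes\dots\otimes{!\mathbb R})\multimap{!\mathbb R}$ ($n$ factors); $\vdash\dot+:(\mathbb R\&\mathbb R)\multimap\mathbb R$; $\vdash\dot*:\mathbb R\multimap\mathbb R\multimap\mathbb R$. **$\beta$-reduction.** Values for a pattern: any term of type $A$ is a value for a variable $x:A$; $()$ is the value for $()$; $!M$ (any $M$) is a value for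 $!x$; $(V_1,V_2)$ (resp. $\langle V_1,V_2\rangle$) is a value for $(p_1,p_2)$ (resp. $\langle p_1,p_2\rangle$) if each $V_i$ is a value for $p_i$. Substitution: $M\{V/x\}$ is capture-avoiding substitution, $M\{()/()\}=M$, $M\{!N/!x\}=M\{N/x\}$, $M\{(V_1,V_2)/(p_1,p_2)\}=M\{\langle V_1,V_2\rangle/\langle p_1,p_2\rangle\}=M\{V_1/p_1\}\{V_2/p_2\}$. The relation $\rightarrow$ is the closure under all one-hole term contexts of: $(\lambda p.M)V\rightarrow M\{V/p\}$ for $V$ a value for $p$; $\underline f(!\underline{r_1},\dots,!\underline{r_n})\rightarrow{!\underline{f(r_1,\dots,r_n)}}$; $\dot+\langle\underline{r_1},\underline{r_2}\rangle\rightarrow\underline{r_1+r_2}$; $\dot*\,\underline{r_1}\,\underline{r_2}\rightarrow\underline{r_1\cdot r_2}$. ($n$-fold $\otimes$ and pairs are right-nested.) *)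

theory Defs
  imports "HOL-Analysis.Analysis"
begin

section \<open>Signatures\<close>

text \<open>Vectors of \<open>\<real>\<^sup>n\<close> are real lists of length \<open>n\<close>, because the arity \<open>n\<close> varies with
  the function symbol. Differentiability is total (Frechet) differentiability at every point
  with respect to the Euclidean norm; the list \<open>a\<close> is the gradient.\<close>

definition vdist :: "real list \<Rightarrow> real list \<Rightarrow> real" where
  "vdist x y = L2_set (\<lambda>i. y ! i - x ! i) {..<length x}"

definition differentiable_Rn :: "nat \<Rightarrow> (real list \<Rightarrow> real) \<Rightarrow> bool" where
  "differentiable_Rn n F \<longleftrightarrow>
    (\<forall>x. length x = n \<longrightarrow>
      (\<exists>a. length a = n \<and>
        (\<forall>e>0. \<exists>d>0. \<forall>y. length y = n \<and> vdist x y < d \<longrightarrow>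
          \<bar>F y - F x - (\<Sum>i<n. a ! i * (y ! i - x ! i))\<bar> \<le> e * vdist x y)))"

text \<open>A signature is a type \<open>'f\<close> of function symbols with an arity and a denotation. Only the
  values of \<open>den f\<close> on lists of length \<open>ar f\<close> matter.\<close>

definition signature :: "('f \<Rightarrow> nat) \<Rightarrow> ('f \<Rightarrow> real list \<Rightarrow> real) \<Rightarrow> bool" where
  "signature ar den \<longleftrightarrow> (\<forall>f. ar f \<ge> 1 \<and> differentiable_Rn (ar f) (den f))"

section \<open>Types, variables and patterns\<close>

datatype ty = RealT | Lolli ty ty | OneT | TensorT ty ty | TopT | WithT ty ty | OfCourse ty

text \<open>A variable carries its type, and there are infinitely many variables of each type.\<close>

type_synonym var = "nat \<times> ty"

text \<open>Patterns over variables have type \<open>var pat\<close>. A binder inside a term only remembers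
  the types of the bound variables and is a \<open>ty pat\<close> (see below).\<close>

datatype 'v pat = PVar 'v | PBang 'v | PUnit | PTensor "'v pat" "'v pat" | PWith "'v pat" "'v pat"

fun pvars :: "'v pat \<Rightarrow> 'v list" where
  "pvars (PVar x) = [x]"
| "pvars (PBang x) = [x]"
| "pvars PUnit = []"
| "pvars (PTensor p q) = pvars p @ pvars q"
| "pvars (PWith p q) = pvars p @ pvars q"

text \<open>The condition that no variable occurs twice in a pattern.\<close>

definition linear_pat :: "var pat \<Rightarrow> bool" where
  "linear_pat p \<longleftrightarrow> distinct (pvars p)"

fun pty :: "var pat \<Rightarrow> ty" where
  "pty (PVar x) = snd x"
| "pty (PBang x) = OfCourse (snd x)"
| "pty PUnit = OneT"
| "pty (PTensor p q) = TensorT (pty p) (pty q)"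
| "pty (PWith p q) = WithT (pty p) (pty q)"

section \<open>Terms up to alpha-equivalence\<close>

text \<open>Terms are represented in locally nameless style, so that alpha-equivalence is equality:
  free variables are named, and \<open>Bound k i\<close> is the \<open>i\<close>-th variable of the pattern of the
  \<open>k\<close>-th enclosing abstraction (counted from the inside, from 0). The raw constructors \<open>Bound\<close>
  and \<open>Lam\<close> are not used in the definition of the calculus: abstractions are always formed with
  \<open>lam p M\<close> below, which binds the variables of the named pattern \<open>p\<close> in \<open>M\<close>.\<close>

datatype 'f trm =
    Free var
  | Bound nat nat
  | Bang "'f trm"
  | Lam "ty pat" "'f trm"
  | App "'f trm" "'f trm"
  | UnitTm
  | TensorTm "'f trm" "'f trm"
  | TopTm
  | WithTm "'f trm" "'f trm"
  | Const real
  | Fun 'f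
  | Add
  | Mul

fun bind_vars :: "nat \<Rightarrow> var list \<Rightarrow> 'f trm \<Rightarrow> 'f trm" where
  "bind_vars k xs (Free x) =
    (case map_of (zip xs [0..<length xs]) x of None \<Rightarrow> Free x | Some i \<Rightarrow> Bound k i)"
| "bind_vars k xs (Bound l i) = Bound l i"
| "bind_vars k xs (Bang M) = Bang (bind_vars k xs M)"
| "bind_vars k xs (Lam s M) = Lam s (bind_vars (Suc k) xs M)"
| "bind_vars k xs (App M N) = App (bind_vars k xs M) (bind_vars k xs N)"
| "bind_vars k xs UnitTm = UnitTm"
| "bind_vars k xs (TensorTm M N) = TensorTm (bind_vars k xs M) (bind_vars k xs N)"
| "bind_vars k xs TopTm = TopTm"
| "bind_vars k xs (WithTm M N) = WithTm (bind_vars k xs M) (bind_vars k xs N)"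
| "bind_vars k xs (Const r) = Const r"
| "bind_vars k xs (Fun f) = Fun f"
| "bind_vars k xs Add = Add"
| "bind_vars k xs Mul = Mul"

definition lam :: "var pat \<Rightarrow> 'f trm \<Rightarrow> 'f trm" where
  "lam p M = Lam (map_pat snd p) (bind_vars 0 (pvars p) M)"

text \<open>The grammar of (not necessarily well-typed) terms. It excludes exactly the raw terms
  with dangling bound variables.\<close>

inductive is_term :: "'f trm \<Rightarrow> bool" where
  "is_term (Free x)"
| "is_term M \<Longrightarrow> is_term (Bang M)"
| "linear_pat p \<Longrightarrow> is_term M \<Longrightarrow> is_term (lam p M)"
| "is_term M \<Longrightarrow> is_term N \<Longrightarrow> is_term (App M N)"
| "is_term UnitTm"
| "is_term M \<Longrightarrow> is_term N \<Longrightarrow> is_term (TensorTm M N)"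
| "is_term TopTm"
| "is_term M \<Longrightarrow> is_term N \<Longrightarrow> is_term (WithTm M N)"
| "is_term (Const r)"
| "is_term (Fun f)"
| "is_term Add"
| "is_term Mul"

fun fv :: "'f trm \<Rightarrow> var set" where
  "fv (Free x) = {x}"
| "fv (Bang M) = fv M"
| "fv (Lam s M) = fv M"
| "fv (App M N) = fv M \<union> fv N"
| "fv (TensorTm M N) = fv M \<union> fv N"
| "fv (WithTm M N) = fv M \<union> fv N"
| "fv _ = {}"

text \<open>Substitution of \<open>N\<close> for the free variable \<open>x\<close>. If \<^term>\<open>is_term N\<close>, then \<open>N\<close> has no
  dangling bound variable and nothing can be captured.\<close>

fun subst :: "var \<Rightarrow> 'f trm \<Rightarrow> 'f trm \<Rightarrow> 'f trm" where
  "subst x N (Free y) = (if y = x then N else Free y)"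
| "subst x N (Bound l i) = Bound l i"
| "subst x N (Bang M) = Bang (subst x N M)"
| "subst x N (Lam s M) = Lam s (subst x N M)"
| "subst x N (App M M') = App (subst x N M) (subst x N M')"
| "subst x N UnitTm = UnitTm"
| "subst x N (TensorTm M M') = TensorTm (subst x N M) (subst x N M')"
| "subst x N TopTm = TopTm"
| "subst x N (WithTm M M') = WithTm (subst x N M) (subst x N M')"
| "subst x N (Const r) = Const r"
| "subst x N (Fun f) = Fun f"
| "subst x N Add = Add"
| "subst x N Mul = Mul"

text \<open>Renaming a bound variable does not change the term.\<close>

lemma bind_vars_rename:
  assumes "y \<notin> fv M" and "snd y = snd x"
  shows "bind_vars k [y] (subst x (Free y) M) = bind_vars k [x] M"
  using assms by (induction M arbitrary: k) auto

lemma lam_rename: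
  assumes "y \<notin> fv M" and "snd y = snd x"
  shows "lam (PVar y) (subst x (Free y) M) = lam (PVar x) M"
  using assms by (simp add: lam_def bind_vars_rename)

section \<open>Typing\<close>

text \<open>The type of a pattern is determined by the pattern, so an environment of typed patterns
  is a set of patterns.\<close>

type_synonym env = "var pat set"

definition evars :: "env \<Rightarrow> var set" where
  "evars \<Delta> = (\<Union>p\<in>\<Delta>. set (pvars p))"

definition is_env :: "env \<Rightarrow> bool" where
  "is_env \<Delta> \<longleftrightarrow> finite \<Delta> \<and> (\<forall>p\<in>\<Delta>. linear_pat p) \<and>
    (\<forall>p\<in>\<Delta>. \<forall>q\<in>\<Delta>. p \<noteq> q \<longrightarrow> set (pvars p) \<inter> set (pvars q) = {})"

definition exponential :: "env \<Rightarrow> bool" where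
  "exponential \<Gamma> \<longleftrightarrow> (\<forall>p\<in>\<Gamma>. \<exists>x. p = PBang x)"

text \<open>The side condition of the comma: the listed environments pairwise have no variable in
  common.\<close>

definition apart :: "env list \<Rightarrow> bool" where
  "apart \<Delta>s \<longleftrightarrow> sorted_wrt (\<lambda>\<Gamma> \<Delta>. evars \<Gamma> \<inter> evars \<Delta> = {}) \<Delta>s"

text \<open>Right-nested \<open>n\<close>-fold tensors, for \<open>n \<ge> 1\<close>; the cases of length 0 are irrelevant.\<close>

fun tensor_pow :: "ty \<Rightarrow> nat \<Rightarrow> ty" where
  "tensor_pow A 0 = OneT"
| "tensor_pow A (Suc 0) = A"
| "tensor_pow A (Suc (Suc n)) = TensorT A (tensor_pow A (Suc n))"

fun tuple :: "'f trm list \<Rightarrow> 'f trm" where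
  "tuple [] = UnitTm"
| "tuple [M] = M"
| "tuple (M # N # Ms) = TensorTm M (tuple (N # Ms))"

inductive typing :: "('f \<Rightarrow> nat) \<Rightarrow> env \<Rightarrow> 'f trm \<Rightarrow> ty \<Rightarrow> bool" for ar where
  var: "typing ar {PVar x} (Free x) (snd x)"
| bang_var: "typing ar {PBang x} (Free x) (snd x)"
| promotion: "exponential \<Gamma> \<Longrightarrow> typing ar \<Gamma> M A \<Longrightarrow> typing ar \<Gamma> (Bang M) (OfCourse A)"
| weakening: "typing ar \<Delta> M B \<Longrightarrow> apart [{PBang x}, \<Delta>] \<Longrightarrow> typing ar ({PBang x} \<union> \<Delta>) M B"
| lam: "typing ar ({p} \<union> \<Delta>) M B \<Longrightarrow> apart [{p}, \<Delta>] \<Longrightarrow>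
    typing ar \<Delta> (lam p M) (Lolli (pty p) B)"
| app: "typing ar (\<Gamma>1 \<union> \<Delta>1) M (Lolli A B) \<Longrightarrow> typing ar (\<Gamma>2 \<union> \<Delta>2) N A \<Longrightarrow>
    exponential \<Gamma>1 \<Longrightarrow> exponential \<Gamma>2 \<Longrightarrow> apart [\<Gamma>1 \<union> \<Gamma>2, \<Delta>1, \<Delta>2] \<Longrightarrow>
    typing ar (\<Gamma>1 \<union> \<Gamma>2 \<union> \<Delta>1 \<union> \<Delta>2) (App M N) B"
| unit: "typing ar {} UnitTm OneT"
| unit_pat: "typing ar \<Delta> M B \<Longrightarrow> typing ar ({PUnit} \<union> \<Delta>) M B"
| tensor_pair: "typing ar (\<Gamma>1 \<union> \<Delta>1) M A \<Longrightarrow> typing ar (\<Gamma>2 \<union> \<Delta>2) N B \<Longrightarrow>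
    exponential \<Gamma>1 \<Longrightarrow> exponential \<Gamma>2 \<Longrightarrow> apart [\<Gamma>1 \<union> \<Gamma>2, \<Delta>1, \<Delta>2] \<Longrightarrow>
    typing ar (\<Gamma>1 \<union> \<Gamma>2 \<union> \<Delta>1 \<union> \<Delta>2) (TensorTm M N) (TensorT A B)"
| tensor_pat: "typing ar ({p} \<union> {q} \<union> \<Delta>) M C \<Longrightarrow> apart [{p}, {q}, \<Delta>] \<Longrightarrow>
    typing ar ({PTensor p q} \<union> \<Delta>) M C"
| with_pair: "typing ar \<Delta> M1 A1 \<Longrightarrow> typing ar \<Delta> M2 A2 \<Longrightarrow>
    typing ar \<Delta> (WithTm M1 M2) (WithT A1 A2)"
| with_pat1: "typing ar ({p1} \<union> \<Delta>) M B \<Longrightarrow> linear_pat p2 \<Longrightarrow> apart [{p1}, {p2}, \<Delta>] \<Longrightarrow>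
    typing ar ({PWith p1 p2} \<union> \<Delta>) M B"
| with_pat2: "typing ar ({p2} \<union> \<Delta>) M B \<Longrightarrow> linear_pat p1 \<Longrightarrow> apart [{p1}, {p2}, \<Delta>] \<Longrightarrow>
    typing ar ({PWith p1 p2} \<union> \<Delta>) M B"
| top: "is_env \<Delta> \<Longrightarrow> typing ar \<Delta> TopTm TopT"
| const: "typing ar {} (Const r) RealT"
| zero: "is_env \<Delta> \<Longrightarrow> typing ar \<Delta> (Const 0) RealT"
| func: "typing ar {} (Fun f) (Lolli (tensor_pow (OfCourse RealT) (ar f)) (OfCourse RealT))"
| add: "typing ar {} Add (Lolli (WithT RealT RealT) RealT)"
| mul: "typing ar {} Mul (Lolli RealT (Lolli RealT RealT))"

definition well_typed :: "('f \<Rightarrow> nat) \<Rightarrow> 'f trm \<Rightarrow> bool" where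
  "well_typed ar M \<longleftrightarrow> (\<exists>\<Delta> A. typing ar \<Delta> M A)"

section \<open>Beta-reduction\<close>

fun is_value :: "('f \<Rightarrow> nat) \<Rightarrow> var pat \<Rightarrow> 'f trm \<Rightarrow> bool" where
  "is_value ar (PVar x) V \<longleftrightarrow> (\<exists>\<Delta>. typing ar \<Delta> V (snd x))"
| "is_value ar (PBang x) V \<longleftrightarrow> (\<exists>N. V = Bang N)"
| "is_value ar PUnit V \<longleftrightarrow> V = UnitTm"
| "is_value ar (PTensor p q) V \<longleftrightarrow>
    (\<exists>V1 V2. V = TensorTm V1 V2 \<and> is_value ar p V1 \<and> is_value ar q V2)"
| "is_value ar (PWith p q) V \<longleftrightarrow>
    (\<exists>V1 V2. V = WithTm V1 V2 \<and> is_value ar p V1 \<and> is_value ar q V2)"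

text \<open>\<open>psubst p V M\<close> is \<open>M{V/p}\<close>; the last equation is never used for a value \<open>V\<close> for \<open>p\<close>.\<close>

fun psubst :: "var pat \<Rightarrow> 'f trm \<Rightarrow> 'f trm \<Rightarrow> 'f trm" where
  "psubst (PVar x) V M = subst x V M"
| "psubst (PBang x) (Bang N) M = subst x N M"
| "psubst PUnit UnitTm M = M"
| "psubst (PTensor p q) (TensorTm V1 V2) M = psubst q V2 (psubst p V1 M)"
| "psubst (PWith p q) (WithTm V1 V2) M = psubst q V2 (psubst p V1 M)"
| "psubst _ _ M = M"

text \<open>In \<open>beta\<close> the bound variables are chosen (up to alpha-equivalence) apart from the free
  variables of \<open>V\<close>, since \<open>M{V/p}\<close> substitutes for the variables of \<open>p\<close> one after the other.
  The \<open>is_term\<close> premises restrict the relation to terms, that is, they exclude raw terms with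
  dangling bound variables.\<close>

inductive step ::
  "('f \<Rightarrow> nat) \<Rightarrow> ('f \<Rightarrow> real list \<Rightarrow> real) \<Rightarrow> 'f trm \<Rightarrow> 'f trm \<Rightarrow> bool" for ar den where
  beta: "linear_pat p \<Longrightarrow> is_term M \<Longrightarrow> is_term V \<Longrightarrow> set (pvars p) \<inter> fv V = {} \<Longrightarrow>
    is_value ar p V \<Longrightarrow> step ar den (App (lam p M) V) (psubst p V M)"
| func: "length rs = ar f \<Longrightarrow>
    step ar den (App (Fun f) (tuple (map (\<lambda>r. Bang (Const r)) rs))) (Bang (Const (den f rs)))"
| add: "step ar den (App Add (WithTm (Const r1) (Const r2))) (Const (r1 + r2))"
| mul: "step ar den (App (App Mul (Const r1)) (Const r2)) (Const (r1 * r2))"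
| bang: "step ar den M M' \<Longrightarrow> step ar den (Bang M) (Bang M')"
| lam: "linear_pat p \<Longrightarrow> step ar den M M' \<Longrightarrow> step ar den (lam p M) (lam p M')"
| appL: "step ar den M M' \<Longrightarrow> is_term N \<Longrightarrow> step ar den (App M N) (App M' N)"
| appR: "step ar den N N' \<Longrightarrow> is_term M \<Longrightarrow> step ar den (App M N) (App M N')"
| tensorL: "step ar den M M' \<Longrightarrow> is_term N \<Longrightarrow> step ar den (TensorTm M N) (TensorTm M' N)"
| tensorR: "step ar den N N' \<Longrightarrow> is_term M \<Longrightarrow> step ar den (TensorTm M N) (TensorTm M N')"
| withL: "step ar den M M' \<Longrightarrow> is_term N \<Longrightarrow> step ar den (WithTm M N) (WithTm M' N)"
| withR: "step ar den N N' \<Longrightarrow> is_term M \<Longrightarrow> step ar den (WithTm M N) (WithTm M N')"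

end

theory Submission
  imports Defs
begin

text \<open>Forgetting types turns reduction into an orthogonal rewriting relation on raw terms, in which
  a variable pattern matches anything; orthogonality holds because matching a pattern is stable
  under reduction of the value. Parallel reduction together with complete developments
  (Takahashi's method) shows that this relation is confluent. Types are needed only for the side
  condition of the beta rule that a value for a variable has the type of the variable. By subject
  reduction every untyped step from a well-typed term is a step of the calculus and its result is
  well-typed, so a common reduct of well-typed terms in the untyped system is one in the calculus.

  The substitution lemma behind subject reduction substitutes simultaneously for all patterns of
  an environment. A right rule splits the environment of the substituted values, which is possible
  only after some left rules have decomposed the patterns in it; hence all statements about that
  environment are made up to closure under the left rules. Renaming of bound variables is an
  instance of the same lemma.\<close>

section \<open>Simultaneous substitution\<close>

text \<open>A split environment may need decomposing first for the following reason. The value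
  \<open>(a, b)\<close> of a pattern \<open>(x, y)\<close> can be typed in the environment whose
  only pattern is \<open>(a, b)\<close>. If the body is the application of \<open>x\<close> to
  \<open>y\<close>, neither side can receive its share of this environment before the left tensor
  rule has turned it into \<open>a, b\<close>. That environments are sets causes a second
  difficulty. A pattern without variables, such as \<open>()\<close>, has no variable in common with
  itself, so disjointness of variables does not keep it from standing on both sides of a split, just
  as \<open>!x\<close> may. What is substituted for such patterns must therefore tolerate
  duplication. Arithmetic preserves typing by an interplay of two facts: 0 is typable in every
  well-formed environment, and the environment of a nonzero constant can be reduced to the empty one
  by left rules.\<close>

fun ren :: "(nat \<Rightarrow> nat) \<Rightarrow> 'f trm \<Rightarrow> 'f trm" where
  "ren \<rho> (Free x) = Free x"
| "ren \<rho> (Bound l i) = Bound (\<rho> l) i"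
| "ren \<rho> (Bang M) = Bang (ren \<rho> M)"
| "ren \<rho> (Lam s M) = Lam s (ren (case_nat 0 (\<lambda>l. Suc (\<rho> l))) M)"
| "ren \<rho> (App M N) = App (ren \<rho> M) (ren \<rho> N)"
| "ren \<rho> UnitTm = UnitTm"
| "ren \<rho> (TensorTm M N) = TensorTm (ren \<rho> M) (ren \<rho> N)"
| "ren \<rho> TopTm = TopTm"
| "ren \<rho> (WithTm M N) = WithTm (ren \<rho> M) (ren \<rho> N)"
| "ren \<rho> (Const r) = Const r"
| "ren \<rho> (Fun f) = Fun f"
| "ren \<rho> Add = Add"
| "ren \<rho> Mul = Mul"

definition up :: "(nat \<Rightarrow> nat \<Rightarrow> 'f trm) \<Rightarrow> nat \<Rightarrow> nat \<Rightarrow> 'f trm" where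
  "up \<sigma> = case_nat (Bound 0) (\<lambda>l i. ren Suc (\<sigma> l i))"

lemma up_simps [simp]: "up \<sigma> 0 = Bound 0" "up \<sigma> (Suc l) = (\<lambda>i. ren Suc (\<sigma> l i))"
  by (simp_all add: up_def)

lemma up_Bound [simp]: "up Bound = Bound"
  by (intro ext) (simp add: up_def split: nat.split)

text \<open>Names and indices are substituted at once, so that index renaming, binding, substitution
  for a name and opening of a body are all instances, and \<open>sub_sub\<close> yields their
  commutation laws. Images of names are shifted under a binder because \<open>bindmap\<close> sends
  names to indices, which must keep pointing past that binder.\<close>

fun sub :: "(var \<Rightarrow> 'f trm) \<Rightarrow> (nat \<Rightarrow> nat \<Rightarrow> 'f trm) \<Rightarrow> 'f trm \<Rightarrow> 'f trm" where
  "sub \<tau> \<sigma> (Free x) = \<tau> x"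
| "sub \<tau> \<sigma> (Bound l i) = \<sigma> l i"
| "sub \<tau> \<sigma> (Bang M) = Bang (sub \<tau> \<sigma> M)"
| "sub \<tau> \<sigma> (Lam s M) = Lam s (sub (\<lambda>x. ren Suc (\<tau> x)) (up \<sigma>) M)"
| "sub \<tau> \<sigma> (App M N) = App (sub \<tau> \<sigma> M) (sub \<tau> \<sigma> N)"
| "sub \<tau> \<sigma> UnitTm = UnitTm"
| "sub \<tau> \<sigma> (TensorTm M N) = TensorTm (sub \<tau> \<sigma> M) (sub \<tau> \<sigma> N)"
| "sub \<tau> \<sigma> TopTm = TopTm"
| "sub \<tau> \<sigma> (WithTm M N) = WithTm (sub \<tau> \<sigma> M) (sub \<tau> \<sigma> N)"
| "sub \<tau> \<sigma> (Const r) = Const r"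
| "sub \<tau> \<sigma> (Fun f) = Fun f"
| "sub \<tau> \<sigma> Add = Add"
| "sub \<tau> \<sigma> Mul = Mul"

lemma sub_Free_Bound [simp]: "sub Free Bound M = M"
  by (induction M) auto

lemma ren_conv_sub: "ren \<rho> M = sub Free (\<lambda>l. Bound (\<rho> l)) M"
proof (induction M arbitrary: \<rho>)
  case (Lam s M)
  have "up (\<lambda>l. Bound (\<rho> l)) = (\<lambda>l. Bound (case_nat 0 (\<lambda>l. Suc (\<rho> l)) l) :: nat \<Rightarrow> 'a trm)"
    by (intro ext) (simp add: up_def split: nat.split)
  with Lam show ?case by simp
qed auto

lemma sub_ren: "sub \<tau> \<sigma> (ren \<rho> M) = sub \<tau> (\<lambda>l. \<sigma> (\<rho> l)) M"
proof (induction M arbitrary: \<rho> \<tau> \<sigma>)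
  case (Lam s M)
  have "(\<lambda>l. up \<sigma> (case_nat 0 (\<lambda>l. Suc (\<rho> l)) l)) = up (\<lambda>l. \<sigma> (\<rho> l))"
    by (intro ext) (simp add: up_def split: nat.split)
  with Lam show ?case by simp
qed auto

lemma ren_ren: "ren \<rho> (ren \<rho>' M) = ren (\<lambda>l. \<rho> (\<rho>' l)) M"
  by (simp add: ren_conv_sub[of \<rho>] ren_conv_sub[of "\<lambda>l. \<rho> (\<rho>' l)"] sub_ren)

lemma ren_sub: "ren \<rho> (sub \<tau> \<sigma> M) = sub (\<lambda>x. ren \<rho> (\<tau> x)) (\<lambda>l i. ren \<rho> (\<sigma> l i)) M"
proof (induction M arbitrary: \<rho> \<tau> \<sigma>)
  case (Lam s M)
  have "(\<lambda>l i. ren (case_nat 0 (\<lambda>l. Suc (\<rho> l))) (up \<sigma> l i)) = up (\<lambda>l i. ren \<rho> (\<sigma> l i))"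
    by (intro ext) (simp add: up_def ren_ren split: nat.split)
  with Lam show ?case by (simp add: ren_ren)
qed auto

text \<open>Under a binder the shift \<open>ren Suc\<close> has to pass a substitution on either
  side, hence \<open>sub_ren\<close> and \<open>ren_sub\<close> come first.\<close>

lemma sub_sub: "sub \<tau> \<sigma> (sub \<tau>' \<sigma>' M) =
    sub (\<lambda>x. sub \<tau> \<sigma> (\<tau>' x)) (\<lambda>l i. sub \<tau> \<sigma> (\<sigma>' l i)) M"
proof (induction M arbitrary: \<tau> \<sigma> \<tau>' \<sigma>')
  case (Lam s M)
  have "(\<lambda>l i. sub (\<lambda>x. ren Suc (\<tau> x)) (up \<sigma>) (up \<sigma>' l i)) = up (\<lambda>l i. sub \<tau> \<sigma> (\<sigma>' l i))"
    by (intro ext) (simp add: up_def sub_ren ren_sub split: nat.split)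
  with Lam show ?case by (simp add: sub_ren ren_sub)
qed auto

section \<open>Locally closed terms; binding and opening as substitutions\<close>

fun lc :: "nat \<Rightarrow> 'f trm \<Rightarrow> bool" where
  "lc k (Bound l i) \<longleftrightarrow> l < k"
| "lc k (Bang M) \<longleftrightarrow> lc k M"
| "lc k (Lam s M) \<longleftrightarrow> lc (Suc k) M"
| "lc k (App M N) \<longleftrightarrow> lc k M \<and> lc k N"
| "lc k (TensorTm M N) \<longleftrightarrow> lc k M \<and> lc k N"
| "lc k (WithTm M N) \<longleftrightarrow> lc k M \<and> lc k N"
| "lc k _ \<longleftrightarrow> True"

lemma sub_cong:
  assumes "lc k M" and "\<And>x. x \<in> fv M \<Longrightarrow> \<tau> x = \<tau>' x" and "\<And>l i. l < k \<Longrightarrow> \<sigma> l i = \<sigma>' l i"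
  shows "sub \<tau> \<sigma> M = sub \<tau>' \<sigma>' M"
  using assms
proof (induction M arbitrary: k \<tau> \<sigma> \<tau>' \<sigma>')
  case (Lam s M)
  have "sub (\<lambda>x. ren Suc (\<tau> x)) (up \<sigma>) M = sub (\<lambda>x. ren Suc (\<tau>' x)) (up \<sigma>') M"
    using Lam.prems by (intro Lam.IH[of "Suc k"]) (auto simp: up_def split: nat.split)
  then show ?case by simp
next
  case (App M N)
  have "sub \<tau> \<sigma> M = sub \<tau>' \<sigma>' M" "sub \<tau> \<sigma> N = sub \<tau>' \<sigma>' N"
    by (rule App.IH[of k]; use App.prems in simp)+
  then show ?case by simp
next
  case (TensorTm M N)
  have "sub \<tau> \<sigma> M = sub \<tau>' \<sigma>' M" "sub \<tau> \<sigma> N = sub \<tau>' \<sigma>' N"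
    by (rule TensorTm.IH[of k]; use TensorTm.prems in simp)+
  then show ?case by simp
next
  case (WithTm M N)
  have "sub \<tau> \<sigma> M = sub \<tau>' \<sigma>' M" "sub \<tau> \<sigma> N = sub \<tau>' \<sigma>' N"
    by (rule WithTm.IH[of k]; use WithTm.prems in simp)+
  then show ?case by simp
next
  case (Bang M)
  have "sub \<tau> \<sigma> M = sub \<tau>' \<sigma>' M"
    by (rule Bang.IH[of k]; use Bang.prems in simp)
  then show ?case by simp
qed auto

lemma sub_lc_id:
  assumes "lc 0 M" and "\<And>x. x \<in> fv M \<Longrightarrow> \<tau> x = Free x"
  shows "sub \<tau> \<sigma> M = M"
  using sub_cong[of 0 M \<tau> Free \<sigma> Bound] assms by simp

lemma ren_lc [simp]: "lc 0 M \<Longrightarrow> ren \<rho> M = M"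
  by (simp add: ren_conv_sub sub_lc_id)

lemma lc_bind_vars: "lc k M \<Longrightarrow> lc (Suc k) (bind_vars k xs M)"
  by (induction M arbitrary: k) (auto split: option.split)

lemma is_term_lc: "is_term M \<Longrightarrow> lc 0 M"
  by (induction rule: is_term.induct) (auto simp: lam_def lc_bind_vars)

definition bindmap :: "nat \<Rightarrow> var list \<Rightarrow> var \<Rightarrow> 'f trm" where
  "bindmap k xs x =
    (case map_of (zip xs [0..<length xs]) x of None \<Rightarrow> Free x | Some i \<Rightarrow> Bound k i)"

lemma bind_vars_conv_sub: "bind_vars k xs M = sub (bindmap k xs) Bound M"
proof (induction M arbitrary: k)
  case (Lam s M)
  have "(\<lambda>x. ren Suc (bindmap k xs x)) = (bindmap (Suc k) xs :: var \<Rightarrow> 'a trm)"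
  proof
    fix x
    show "ren Suc (bindmap k xs x) = (bindmap (Suc k) xs x :: 'a trm)"
      by (cases "map_of (zip xs [0..<length xs]) x")
        (auto simp: bindmap_def simp del: map_of_zip_is_None)
  qed
  with Lam show ?case by simp
qed (auto simp: bindmap_def)

lemma bindmap_nth: "distinct xs \<Longrightarrow> i < length xs \<Longrightarrow> bindmap k xs (xs ! i) = Bound k i"
  by (simp add: bindmap_def map_of_zip_nth)

lemma bindmap_notin: "x \<notin> set xs \<Longrightarrow> bindmap k xs x = Free x"
  using map_of_zip_is_None[of xs "[0..<length xs]" x]
  by (simp add: bindmap_def del: map_of_zip_is_None)

text \<open>\<open>subst\<close> does not shift \<open>N\<close> under a binder while
  \<open>sub\<close> does; a locally closed \<open>N\<close> is unchanged by shifting, so they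
  agree.\<close>

lemma subst_conv_sub: "lc 0 N \<Longrightarrow> subst x N M = sub (Free(x := N)) Bound M"
proof (induction M)
  case (Lam s M)
  then have "(\<lambda>y. ren Suc ((Free(x := N)) y)) = Free(x := N)" by (intro ext) simp
  with Lam show ?case by simp
qed auto

text \<open>An index outside the list yields the junk value \<^term>\<open>UnitTm\<close>, which is invariant under
  every substitution.\<close>

definition inst :: "'f trm list \<Rightarrow> 'f trm \<Rightarrow> 'f trm" where
  "inst vs = sub Free (case_nat (\<lambda>i. if i < length vs then vs ! i else UnitTm) Bound)"

text \<open>This commutation makes beta contraction stable under substitution.\<close>

lemma sub_inst:
  "sub \<tau> \<sigma> (inst vs B) = inst (map (sub \<tau> \<sigma>) vs) (sub (\<lambda>x. ren Suc (\<tau> x)) (up \<sigma>) B)"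
  unfolding inst_def sub_sub
  by (rule arg_cong2[where f = "\<lambda>t s. sub t s B"])
     (auto intro!: ext simp: sub_ren up_def split: nat.split)

text \<open>A name in \<open>xs\<close> becomes an index of depth 0 and then its value. Local
  closure of \<open>M\<close> ensures that no other dangling index is opened along with it.\<close>

lemma inst_bind_vars:
  assumes "lc 0 M" and "distinct xs" and "map \<tau> xs = vs" and "\<And>x. x \<notin> set xs \<Longrightarrow> \<tau> x = Free x"
  shows "inst vs (bind_vars 0 xs M) = sub \<tau> Bound M"
  unfolding inst_def bind_vars_conv_sub sub_sub
proof (rule sub_cong[OF assms(1)])
  fix x :: var
  show "sub Free (case_nat (\<lambda>i. if i < length vs then vs ! i else UnitTm) Bound) (bindmap 0 xs x) = \<tau> x"
  proof (cases "x \<in> set xs")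
    case True
    then obtain i where "i < length xs" "x = xs ! i" by (metis in_set_conv_nth)
    then show ?thesis using assms by (auto simp: bindmap_nth)
  qed (use assms in \<open>simp add: bindmap_notin\<close>)
qed simp

section \<open>Pattern matching and tuples of constants\<close>

text \<open>Polymorphic in the variables, so that it serves both the named pattern of
  \<open>lam\<close> and the pattern of types stored in \<open>Lam\<close>.\<close>

fun vmatch :: "'v pat \<Rightarrow> 'f trm \<Rightarrow> bool" where
  "vmatch (PVar x) V \<longleftrightarrow> True"
| "vmatch (PBang x) V \<longleftrightarrow> (\<exists>N. V = Bang N)"
| "vmatch PUnit V \<longleftrightarrow> V = UnitTm"
| "vmatch (PTensor p q) V \<longleftrightarrow> (\<exists>V1 V2. V = TensorTm V1 V2 \<and> vmatch p V1 \<and> vmatch q V2)"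
| "vmatch (PWith p q) V \<longleftrightarrow> (\<exists>V1 V2. V = WithTm V1 V2 \<and> vmatch p V1 \<and> vmatch q V2)"

fun vleaves :: "'v pat \<Rightarrow> 'f trm \<Rightarrow> 'f trm list" where
  "vleaves (PVar x) V = [V]"
| "vleaves (PBang x) (Bang N) = [N]"
| "vleaves (PTensor p q) (TensorTm V1 V2) = vleaves p V1 @ vleaves q V2"
| "vleaves (PWith p q) (WithTm V1 V2) = vleaves p V1 @ vleaves q V2"
| "vleaves _ _ = []"

lemma vmatch_map_pat [simp]: "vmatch (map_pat f p) V \<longleftrightarrow> vmatch p V"
  by (induction p arbitrary: V) auto

lemma vleaves_map_pat [simp]: "vleaves (map_pat f p) V = vleaves p V"
  by (induction p V rule: vleaves.induct) auto

lemma pvars_map_pat [simp]: "pvars (map_pat f p) = map f (pvars p)"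
  by (induction p) auto

lemma length_vleaves: "vmatch p V \<Longrightarrow> length (vleaves p V) = length (pvars p)"
  by (induction p arbitrary: V) auto

lemma vmatch_sub: "vmatch p V \<Longrightarrow> vmatch p (sub \<tau> \<sigma> V)"
  by (induction p arbitrary: V) auto

lemma vleaves_sub: "vmatch p V \<Longrightarrow> vleaves p (sub \<tau> \<sigma> V) = map (sub \<tau> \<sigma>) (vleaves p V)"
  by (induction p arbitrary: V) auto

definition const_tuple :: "real list \<Rightarrow> 'f trm" where
  "const_tuple rs = tuple (map (\<lambda>r. Bang (Const r)) rs)"

lemma const_tuple_simps [simp]:
  "const_tuple [] = UnitTm" "const_tuple [r] = Bang (Const r)"
  "const_tuple (r # s # rs) = TensorTm (Bang (Const r)) (const_tuple (s # rs))"
  by (simp_all add: const_tuple_def)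

text \<open>\<open>tuple\<close> itself is not injective, as a last component may be a pair. Here
  every component is a \<open>Bang\<close>, so the shape determines the list; this makes the
  \<open>THE\<close> in \<open>contract\<close> well-defined.\<close>

lemma const_tuple_inject [simp]: "const_tuple rs = const_tuple rs' \<longleftrightarrow> rs = rs'"
proof (induction rs arbitrary: rs' rule: induct_list012)
  case 1
  show ?case by (cases rs' rule: remdups_adj.cases) auto
next
  case (2 r)
  show ?case by (cases rs' rule: remdups_adj.cases) auto
next
  case (3 r s rs)
  show ?case by (cases rs' rule: remdups_adj.cases) (auto simp: 3)
qed

lemma sub_const_tuple [simp]: "sub \<tau> \<sigma> (const_tuple rs) = const_tuple rs"
  by (induction rs rule: induct_list012) auto

section \<open>Untyped reduction and its confluence\<close>

text \<open>As a partial function, root reduction is deterministic by construction and being a redex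
  is a test that \<open>dev\<close> can perform. Multiplication is curried, so its redex appears at
  the outer application.\<close>

definition contract :: "('f \<Rightarrow> nat) \<Rightarrow> ('f \<Rightarrow> real list \<Rightarrow> real) \<Rightarrow> 'f trm \<Rightarrow> 'f trm \<Rightarrow> 'f trm option" where
  "contract ar den M N = (case M of
      Lam s B \<Rightarrow> if vmatch s N then Some (inst (vleaves s N) B) else None
    | Fun f \<Rightarrow> if \<exists>rs. length rs = ar f \<and> N = const_tuple rs
        then Some (Bang (Const (den f (THE rs. N = const_tuple rs)))) else None
    | Add \<Rightarrow> (case N of WithTm (Const a) (Const b) \<Rightarrow> Some (Const (a + b)) | _ \<Rightarrow> None)
    | App Mul (Const a) \<Rightarrow> (case N of Const b \<Rightarrow> Some (Const (a * b)) | _ \<Rightarrow> None)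
    | _ \<Rightarrow> None)"

lemma contract_simps [simp]:
  "contract ar den (Lam s B) V = (if vmatch s V then Some (inst (vleaves s V) B) else None)"
  "contract ar den Add (WithTm (Const a) (Const b)) = Some (Const (a + b))"
  "contract ar den (App Mul (Const a)) (Const b) = Some (Const (a * b))"
  "contract ar den Mul V = None"
  by (simp_all add: contract_def)

lemma contract_Fun_const_tuple [simp]:
  "length rs = ar f \<Longrightarrow> contract ar den (Fun f) (const_tuple rs) = Some (Bang (Const (den f rs)))"
  by (auto simp: contract_def)

lemma contract_cases:
  assumes "contract ar den M N = Some R"
  obtains (beta) s B where "M = Lam s B" "vmatch s N" "R = inst (vleaves s N) B"
  | (func) f rs where "M = Fun f" "length rs = ar f" "N = const_tuple rs" "R = Bang (Const (den f rs))"
  | (add) a b where "M = Add" "N = WithTm (Const a) (Const b)" "R = Const (a + b)"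
  | (mul) a b where "M = App Mul (Const a)" "N = Const b" "R = Const (a * b)"
  using assms unfolding contract_def by (auto split: trm.splits if_splits)

lemma contract_sub: "contract ar den M N = Some R \<Longrightarrow> contract ar den (sub \<tau> \<sigma> M) (sub \<tau> \<sigma> N) = Some (sub \<tau> \<sigma> R)"
  by (erule contract_cases) (auto simp: vmatch_sub vleaves_sub sub_inst)

inductive ustep for ar den where
  root: "contract ar den M N = Some R \<Longrightarrow> ustep ar den (App M N) R"
| bang: "ustep ar den M M' \<Longrightarrow> ustep ar den (Bang M) (Bang M')"
| lam: "ustep ar den M M' \<Longrightarrow> ustep ar den (Lam s M) (Lam s M')"
| appL: "ustep ar den M M' \<Longrightarrow> ustep ar den (App M N) (App M' N)"
| appR: "ustep ar den N N' \<Longrightarrow> ustep ar den (App M N) (App M N')"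
| tensorL: "ustep ar den M M' \<Longrightarrow> ustep ar den (TensorTm M N) (TensorTm M' N)"
| tensorR: "ustep ar den N N' \<Longrightarrow> ustep ar den (TensorTm M N) (TensorTm M N')"
| withL: "ustep ar den M M' \<Longrightarrow> ustep ar den (WithTm M N) (WithTm M' N)"
| withR: "ustep ar den N N' \<Longrightarrow> ustep ar den (WithTm M N) (WithTm M N')"

inductive_cases ustep_BangE: "ustep ar den (Bang M) N"
inductive_cases ustep_LamE: "ustep ar den (Lam s M) N"
inductive_cases ustep_App_elim: "ustep ar den (App M M') N"
inductive_cases ustep_TensorTm_elim: "ustep ar den (TensorTm M M') N"
inductive_cases ustep_WithTm_elim: "ustep ar den (WithTm M M') N"

lemma ustep_AppE:
  assumes "ustep ar den (App M N) R"
  obtains (root) "contract ar den M N = Some R"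
  | (left) M' where "R = App M' N" "ustep ar den M M'"
  | (right) N' where "R = App M N'" "ustep ar den N N'"
  using assms by (elim ustep_App_elim) blast+

lemma ustep_TensorTmE:
  assumes "ustep ar den (TensorTm M N) R"
  obtains (left) M' where "R = TensorTm M' N" "ustep ar den M M'"
  | (right) N' where "R = TensorTm M N'" "ustep ar den N N'"
  using assms by (elim ustep_TensorTm_elim) blast+

lemma ustep_WithTmE:
  assumes "ustep ar den (WithTm M N) R"
  obtains (left) M' where "R = WithTm M' N" "ustep ar den M M'"
  | (right) N' where "R = WithTm M N'" "ustep ar den N N'"
  using assms by (elim ustep_WithTm_elim) blast+

lemma ustep_sub: "ustep ar den M M' \<Longrightarrow> ustep ar den (sub \<tau> \<sigma> M) (sub \<tau> \<sigma> M')"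
  by (induction arbitrary: \<tau> \<sigma> rule: ustep.induct) (auto intro: ustep.intros contract_sub)

section \<open>Parallel reduction and complete developments\<close>

text \<open>In \<open>root\<close> the premise on \<open>R0\<close> says that the redex is already
  present before its parts are reduced. If created redexes could be contracted too,
  \<open>par_dev\<close> would fail.\<close>

inductive par for ar den where
  free: "par ar den (Free x) (Free x)"
| bound: "par ar den (Bound l i) (Bound l i)"
| bang: "par ar den M M' \<Longrightarrow> par ar den (Bang M) (Bang M')"
| lam: "par ar den M M' \<Longrightarrow> par ar den (Lam s M) (Lam s M')"
| app: "par ar den M M' \<Longrightarrow> par ar den N N' \<Longrightarrow> par ar den (App M N) (App M' N')"
| root: "par ar den M M' \<Longrightarrow> par ar den N N' \<Longrightarrow> contract ar den M N = Some R0 \<Longrightarrow>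
    contract ar den M' N' = Some R \<Longrightarrow> par ar den (App M N) R"
| unit: "par ar den UnitTm UnitTm"
| tensor: "par ar den M M' \<Longrightarrow> par ar den N N' \<Longrightarrow> par ar den (TensorTm M N) (TensorTm M' N')"
| top: "par ar den TopTm TopTm"
| "with": "par ar den M M' \<Longrightarrow> par ar den N N' \<Longrightarrow> par ar den (WithTm M N) (WithTm M' N')"
| const: "par ar den (Const r) (Const r)"
| func: "par ar den (Fun f) (Fun f)"
| add: "par ar den Add Add"
| mul: "par ar den Mul Mul"

inductive_simps par_simps [simp]:
  "par ar den (Bang M) N" "par ar den (Lam s M) N" "par ar den UnitTm N"
  "par ar den (TensorTm M M') N" "par ar den (WithTm M M') N"
  "par ar den (Const r) N" "par ar den (Fun f) N" "par ar den Add N" "par ar den Mul N"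

lemma par_refl [simp]: "par ar den M M"
  by (induction M) (auto intro: par.intros)

lemma par_ren: "par ar den M M' \<Longrightarrow> par ar den (ren \<rho> M) (ren \<rho> M')"
proof (induction arbitrary: \<rho> rule: par.induct)
  case (root M M' N N' R0 R)
  from root.hyps(3,4)[THEN contract_sub[where \<tau> = Free and \<sigma> = "\<lambda>l. Bound (\<rho> l)"]]
  show ?case using root.IH[of \<rho>] by (auto simp: ren_conv_sub intro: par.root)
qed (auto intro: par.intros)

lemma par_sub:
  assumes "par ar den M M'" and "\<And>x. par ar den (\<tau> x) (\<tau>' x)" and "\<And>l i. par ar den (\<sigma> l i) (\<sigma>' l i)"
  shows "par ar den (sub \<tau> \<sigma> M) (sub \<tau>' \<sigma>' M')"
  using assms
proof (induction arbitrary: \<tau> \<sigma> \<tau>' \<sigma>' rule: par.induct)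
  case (lam M M' s)
  have "par ar den (up \<sigma> l i) (up \<sigma>' l i)" for l i
    by (cases l) (auto intro: par_ren lam.prems)
  then have "par ar den (sub (\<lambda>x. ren Suc (\<tau> x)) (up \<sigma>) M) (sub (\<lambda>x. ren Suc (\<tau>' x)) (up \<sigma>') M')"
    by (intro lam.IH par_ren lam.prems)
  then show ?case by simp
next
  case (root M M' N N' R0 R)
  from root.hyps(3)[THEN contract_sub[where \<tau> = \<tau> and \<sigma> = \<sigma>]] root.hyps(4)[THEN contract_sub[where \<tau> = \<tau>' and \<sigma> = \<sigma>']]
  show ?case unfolding sub.simps
    by (rule par.root[OF root.IH(1)[OF root.prems] root.IH(2)[OF root.prems]])
qed (simp_all add: par.intros)

lemma par_vmatch: "par ar den V V' \<Longrightarrow> vmatch s V \<Longrightarrow> vmatch s V'"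
  by (induction s arbitrary: V V') auto

lemma par_vleaves:
  "par ar den V V' \<Longrightarrow> vmatch s V \<Longrightarrow> list_all2 (par ar den) (vleaves s V) (vleaves s V')"
  by (induction s arbitrary: V V') (auto intro!: list_all2_appendI)

lemma par_const_tuple: "par ar den (const_tuple rs) N \<Longrightarrow> N = const_tuple rs"
  by (induction rs arbitrary: N rule: induct_list012) auto

text \<open>Orthogonality: reducing inside the function or the argument cannot destroy a redex. A
  \<open>Lam\<close> stays a \<open>Lam\<close>, the constructors demanded by a pattern stay in
  place while the leaves reduce pointwise, and the constants reduce only to themselves.\<close>

lemma par_contract:
  assumes "contract ar den M N = Some R" and "par ar den M M'" and "par ar den N N'"
  shows "\<exists>R'. contract ar den M' N' = Some R' \<and> par ar den R R'"
  using assms(1)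
proof (cases rule: contract_cases)
  case (beta s B)
  with assms obtain B' where "M' = Lam s B'" "par ar den B B'" by auto
  moreover have "par ar den (inst (vleaves s N) B) (inst (vleaves s N') B')"
    unfolding inst_def using par_vleaves[OF assms(3) beta(2)] \<open>par ar den B B'\<close>
    by (intro par_sub) (auto split: nat.split simp: list_all2_conv_all_nth)
  ultimately show ?thesis using beta assms by (auto dest: par_vmatch)
next
  case (func f rs)
  with assms have "M' = Fun f" "N' = const_tuple rs" by (auto dest: par_const_tuple)
  with func show ?thesis by simp
next
  case (mul a b)
  \<comment> \<open>The inner application is not a redex, because \<open>contract\<close> fails on
    \<open>Mul\<close>.\<close>
  with assms(2) have "M' = M" by (auto elim!: par.cases[of _ _ "App Mul (Const a)"])
  with mul assms show ?thesis by auto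
qed (use assms in auto)

text \<open>All redexes present in the term are contracted. The \<open>the\<close> is safe: by
  \<open>par_contract\<close> a redex remains one after its parts have been developed.\<close>

fun dev :: "('f \<Rightarrow> nat) \<Rightarrow> ('f \<Rightarrow> real list \<Rightarrow> real) \<Rightarrow> 'f trm \<Rightarrow> 'f trm" where
  "dev ar den (Bang M) = Bang (dev ar den M)"
| "dev ar den (Lam s M) = Lam s (dev ar den M)"
| "dev ar den (App M N) =
    (if contract ar den M N = None then App (dev ar den M) (dev ar den N)
     else the (contract ar den (dev ar den M) (dev ar den N)))"
| "dev ar den (TensorTm M N) = TensorTm (dev ar den M) (dev ar den N)"
| "dev ar den (WithTm M N) = WithTm (dev ar den M) (dev ar den N)"
| "dev ar den M = M"

text \<open>Triangle property: whichever redexes a parallel step contracts, one further step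
  contracts the remaining ones.\<close>

lemma par_dev: "par ar den M N \<Longrightarrow> par ar den N (dev ar den M)"
proof (induction rule: par.induct)
  case (app M M' N N')
  show ?case
  proof (cases "contract ar den M N")
    case None
    with app show ?thesis by (auto intro: par.app)
  next
    \<comment> \<open>The step left this redex alone; it survives in \<open>App M' N'\<close> and is
      contracted now.\<close>
    case (Some R)
    from par_contract[OF Some app.hyps] obtain R' where R': "contract ar den M' N' = Some R'" by auto
    from par_contract[OF R' app.IH] obtain R'' where "contract ar den (dev ar den M) (dev ar den N) = Some R''"
      by auto
    with Some app R' show ?thesis by (auto intro: par.root)
  qed
next
  case (root M M' N N' R0 R)
  from par_contract[OF root.hyps(4) root.IH] root.hyps(3) show ?case by auto
qed (auto intro: par.intros)

lemma ustep_par: "ustep ar den M N \<Longrightarrow> par ar den M N"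
  by (induction rule: ustep.induct) (auto intro: par.app par.root par_refl)

lemma usteps_cong:
  assumes "(ustep ar den)\<^sup>*\<^sup>* M M'"
  shows "(ustep ar den)\<^sup>*\<^sup>* (Bang M) (Bang M')" "(ustep ar den)\<^sup>*\<^sup>* (Lam s M) (Lam s M')"
    "(ustep ar den)\<^sup>*\<^sup>* (App M N) (App M' N)" "(ustep ar den)\<^sup>*\<^sup>* (App N M) (App N M')"
    "(ustep ar den)\<^sup>*\<^sup>* (TensorTm M N) (TensorTm M' N)" "(ustep ar den)\<^sup>*\<^sup>* (TensorTm N M) (TensorTm N M')"
    "(ustep ar den)\<^sup>*\<^sup>* (WithTm M N) (WithTm M' N)" "(ustep ar den)\<^sup>*\<^sup>* (WithTm N M) (WithTm N M')"
  using assms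
  by (induction rule: rtranclp_induct) (auto intro: ustep.intros rtranclp.rtrancl_into_rtrancl)

lemma par_usteps: "par ar den M N \<Longrightarrow> (ustep ar den)\<^sup>*\<^sup>* M N"
proof (induction rule: par.induct)
  case (app M M' N N')
  then show ?case by (meson usteps_cong rtranclp_trans)
next
  case (root M M' N N' R0 R)
  then have "(ustep ar den)\<^sup>*\<^sup>* (App M N) (App M' N')" by (meson usteps_cong rtranclp_trans)
  then show ?case using root by (meson ustep.root rtranclp.rtrancl_into_rtrancl)
next
  case (tensor M M' N N')
  then show ?case by (meson usteps_cong rtranclp_trans)
next
  case ("with" M M' N N')
  then show ?case by (meson usteps_cong rtranclp_trans)
qed (auto intro: usteps_cong)

text \<open>Each single peak closes at the complete development of its source, by
  \<open>par_dev\<close>.\<close>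

lemma pars_strip:
  "(par ar den)\<^sup>*\<^sup>* M N \<Longrightarrow> par ar den M M' \<Longrightarrow> \<exists>N'. par ar den N N' \<and> (par ar den)\<^sup>*\<^sup>* M' N'"
  by (induction rule: rtranclp_induct) (auto, meson par_dev rtranclp.rtrancl_into_rtrancl)

lemma usteps_eq_pars: "(ustep ar den)\<^sup>*\<^sup>* = (par ar den)\<^sup>*\<^sup>*"
proof (intro antisym predicate2I)
  show "(par ar den)\<^sup>*\<^sup>* M N" if "(ustep ar den)\<^sup>*\<^sup>* M N" for M N
    using that ustep_par by (metis mono_rtranclp)
  show "(ustep ar den)\<^sup>*\<^sup>* M N" if "(par ar den)\<^sup>*\<^sup>* M N" for M N
    using that by (induction rule: rtranclp_induct) (auto dest: par_usteps)
qed

lemma ustep_confluent: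
  assumes "(ustep ar den)\<^sup>*\<^sup>* M M1" and "(ustep ar den)\<^sup>*\<^sup>* M M2"
  shows "\<exists>N. (ustep ar den)\<^sup>*\<^sup>* M1 N \<and> (ustep ar den)\<^sup>*\<^sup>* M2 N"
  using assms unfolding usteps_eq_pars
proof (induction rule: rtranclp_induct)
  case base
  then show ?case by auto
next
  case (step M1 M1')
  then obtain N where "(par ar den)\<^sup>*\<^sup>* M1 N" "(par ar den)\<^sup>*\<^sup>* M2 N" by auto
  with step(2) pars_strip show ?case by (metis rtranclp.rtrancl_into_rtrancl)
qed

section \<open>Left rules and inversion of typing\<close>

text \<open>For well-formed environments, this holds iff their union can be split as in the rules for
  applications and tensor pairs. Patterns without variables are compatible with everything.\<close>

definition compat_env :: "env \<Rightarrow> env \<Rightarrow> bool" where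
  "compat_env \<Theta> \<Psi> \<longleftrightarrow> (\<forall>p\<in>\<Theta>. \<forall>q\<in>\<Psi>. set (pvars p) \<inter> set (pvars q) = {} \<or> (p = q \<and> (\<exists>x. p = PBang x)))"

lemma compat_empty [simp]: "compat_env {} \<Psi>" "compat_env \<Theta> {}"
  by (auto simp: compat_env_def)

lemma compat_sym: "compat_env \<Theta> \<Psi> \<Longrightarrow> compat_env \<Psi> \<Theta>"
  unfolding compat_env_def by blast

lemma compat_Un [simp]:
  "compat_env (\<Theta>1 \<union> \<Theta>2) \<Psi> \<longleftrightarrow> compat_env \<Theta>1 \<Psi> \<and> compat_env \<Theta>2 \<Psi>"
  "compat_env \<Psi> (\<Theta>1 \<union> \<Theta>2) \<longleftrightarrow> compat_env \<Psi> \<Theta>1 \<and> compat_env \<Psi> \<Theta>2"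
  unfolding compat_env_def by blast+

lemma compat_disjoint: "evars \<Theta> \<inter> evars \<Psi> = {} \<Longrightarrow> compat_env \<Theta> \<Psi>"
  unfolding compat_env_def evars_def by blast

lemma evars_simps [simp]: "evars {} = {}" "evars (insert p \<Delta>) = set (pvars p) \<union> evars \<Delta>"
  "evars (\<Delta> \<union> \<Theta>) = evars \<Delta> \<union> evars \<Theta>"
  by (auto simp: evars_def)

lemma apart2 [simp]: "apart [\<Gamma>, \<Delta>] \<longleftrightarrow> evars \<Gamma> \<inter> evars \<Delta> = {}"
  and apart3 [simp]: "apart [\<Gamma>, \<Delta>, \<Theta>] \<longleftrightarrow>
    evars \<Gamma> \<inter> evars \<Delta> = {} \<and> evars \<Gamma> \<inter> evars \<Theta> = {} \<and> evars \<Delta> \<inter> evars \<Theta> = {}"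
  by (auto simp: apart_def)

lemma is_env_Un: "is_env \<Theta> \<Longrightarrow> is_env \<Psi> \<Longrightarrow> compat_env \<Theta> \<Psi> \<Longrightarrow> is_env (\<Theta> \<union> \<Psi>)"
  unfolding is_env_def compat_env_def by blast

lemma is_env_subset: "is_env \<Theta> \<Longrightarrow> \<Psi> \<subseteq> \<Theta> \<Longrightarrow> is_env \<Psi>"
  unfolding is_env_def using finite_subset by blast

lemma is_env_empty [simp]: "is_env {}"
  by (simp add: is_env_def)

lemma is_env_single [simp]: "is_env {p} \<longleftrightarrow> linear_pat p"
  by (simp add: is_env_def)

lemma exponential_Un [simp]: "exponential (\<Gamma> \<union> \<Delta>) \<longleftrightarrow> exponential \<Gamma> \<and> exponential \<Delta>"
  by (auto simp: exponential_def)

lemma compat_exponential: "exponential \<Gamma> \<Longrightarrow> exponential \<Delta> \<Longrightarrow> compat_env \<Gamma> \<Delta>"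
  unfolding exponential_def compat_env_def by fastforce

lemma compat_self: "exponential \<Gamma> \<Longrightarrow> compat_env \<Gamma> \<Gamma>"
  by (rule compat_exponential)

lemma split_compat:
  assumes "exponential \<Gamma>1" "exponential \<Gamma>2" "apart [\<Gamma>1 \<union> \<Gamma>2, \<Delta>1, \<Delta>2]"
  shows "compat_env (\<Gamma>1 \<union> \<Delta>1) (\<Gamma>2 \<union> \<Delta>2)"
  using assms
  unfolding compat_Un
  by (intro conjI compat_exponential compat_disjoint) auto

text \<open>All exponential patterns go into the \<open>\<Gamma>\<close> parts, even those occurring
  on one side only; compatibility makes the variables of the rest disjoint.\<close>

lemma compat_split:
  assumes "is_env \<Theta>1" "is_env \<Theta>2" "compat_env \<Theta>1 \<Theta>2"
  obtains \<Gamma>1 \<Delta>1 \<Gamma>2 \<Delta>2 where "\<Theta>1 = \<Gamma>1 \<union> \<Delta>1" "\<Theta>2 = \<Gamma>2 \<union> \<Delta>2"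
    "exponential \<Gamma>1" "exponential \<Gamma>2" "apart [\<Gamma>1 \<union> \<Gamma>2, \<Delta>1, \<Delta>2]"
proof
  let ?E = "{p. \<exists>x. p = PBang x}"
  show "\<Theta>1 = (\<Theta>1 \<inter> ?E) \<union> (\<Theta>1 - ?E)" "\<Theta>2 = (\<Theta>2 \<inter> ?E) \<union> (\<Theta>2 - ?E)" by blast+
  show "exponential (\<Theta>1 \<inter> ?E)" "exponential (\<Theta>2 \<inter> ?E)" by (auto simp: exponential_def)
  have "set (pvars p) \<inter> set (pvars q) = {}"
    if "p \<in> \<Theta>1 \<union> \<Theta>2" "q \<in> \<Theta>1 \<union> \<Theta>2" "p \<in> ?E" "q \<notin> ?E" for p q
    using that assms unfolding is_env_def compat_env_def by blast
  moreover have "set (pvars p) \<inter> set (pvars q) = {}" if "p \<in> \<Theta>1" "q \<in> \<Theta>2" "q \<notin> ?E" for p q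
    using that assms unfolding compat_env_def by blast
  ultimately show "apart [(\<Theta>1 \<inter> ?E) \<union> (\<Theta>2 \<inter> ?E), \<Theta>1 - ?E, \<Theta>2 - ?E]"
    unfolding apart3 evars_def by blast
qed

text \<open>Only the axioms for \<open>TopTm\<close> and 0 assume well-formedness; the remaining
  axioms have it and the side conditions of the other rules preserve it.\<close>

lemma typing_is_env: "typing ar \<Delta> M A \<Longrightarrow> is_env \<Delta>"
proof (induction rule: typing.induct)
  case (weakening \<Delta> M B x)
  then show ?case by (intro is_env_Un compat_disjoint) (auto simp: linear_pat_def)
next
  case (lam p \<Delta> M B)
  then show ?case by (blast intro: is_env_subset)
next
  case (app \<Gamma>1 \<Delta>1 M A B \<Gamma>2 \<Delta>2 N)
  have "\<Gamma>1 \<union> \<Gamma>2 \<union> \<Delta>1 \<union> \<Delta>2 = (\<Gamma>1 \<union> \<Delta>1) \<union> (\<Gamma>2 \<union> \<Delta>2)" by blast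
  with is_env_Un[OF app.IH split_compat[OF app.hyps(3-5)]] show ?case by simp
next
  case (tensor_pair \<Gamma>1 \<Delta>1 M A \<Gamma>2 \<Delta>2 N B)
  have "\<Gamma>1 \<union> \<Gamma>2 \<union> \<Delta>1 \<union> \<Delta>2 = (\<Gamma>1 \<union> \<Delta>1) \<union> (\<Gamma>2 \<union> \<Delta>2)" by blast
  with is_env_Un[OF tensor_pair.IH split_compat[OF tensor_pair.hyps(3-5)]] show ?case by simp
next
  case (unit_pat \<Delta> M B)
  then show ?case by (intro is_env_Un compat_disjoint) (auto simp: linear_pat_def)
next
  case (tensor_pat p q \<Delta> M C)
  then have "linear_pat p" "linear_pat q" "is_env \<Delta>" by (auto simp: is_env_def)
  with tensor_pat show ?case
    by (intro is_env_Un compat_disjoint) (auto simp: linear_pat_def)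
next
  case (with_pat1 p1 \<Delta> M B p2)
  then have "linear_pat p1" "is_env \<Delta>" by (auto simp: is_env_def)
  with with_pat1 show ?case
    by (intro is_env_Un compat_disjoint) (auto simp: linear_pat_def)
next
  case (with_pat2 p2 \<Delta> M B p1)
  then have "linear_pat p2" "is_env \<Delta>" by (auto simp: is_env_def)
  with with_pat2 show ?case
    by (intro is_env_Un compat_disjoint) (auto simp: linear_pat_def)
qed (auto simp: linear_pat_def)

lemma typing_is_term: "typing ar \<Delta> M A \<Longrightarrow> is_term M"
proof (induction rule: typing.induct)
  case (lam p \<Delta> M B)
  from typing_is_env[OF lam.hyps(1)] have "linear_pat p" by (simp add: is_env_def)
  then show ?case using lam.IH by (rule is_term.intros)
qed (auto intro: is_term.intros)

lemma typing_lc: "typing ar \<Delta> M A \<Longrightarrow> lc 0 M"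
  by (simp add: is_term_lc typing_is_term)

lemma typing_App:
  assumes "typing ar \<Theta>1 M (Lolli A B)" "typing ar \<Theta>2 N A" "compat_env \<Theta>1 \<Theta>2"
  shows "typing ar (\<Theta>1 \<union> \<Theta>2) (App M N) B"
proof -
  from assms obtain \<Gamma>1 \<Delta>1 \<Gamma>2 \<Delta>2 where *: "\<Theta>1 = \<Gamma>1 \<union> \<Delta>1" "\<Theta>2 = \<Gamma>2 \<union> \<Delta>2"
    "exponential \<Gamma>1" "exponential \<Gamma>2" "apart [\<Gamma>1 \<union> \<Gamma>2, \<Delta>1, \<Delta>2]"
    by (meson compat_split typing_is_env)
  then have "typing ar (\<Gamma>1 \<union> \<Gamma>2 \<union> \<Delta>1 \<union> \<Delta>2) (App M N) B"
    using assms by (intro typing.app) auto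
  moreover have "\<Gamma>1 \<union> \<Gamma>2 \<union> \<Delta>1 \<union> \<Delta>2 = \<Theta>1 \<union> \<Theta>2" using * by blast
  ultimately show ?thesis by simp
qed

lemma typing_TensorTm:
  assumes "typing ar \<Theta>1 M A" "typing ar \<Theta>2 N B" "compat_env \<Theta>1 \<Theta>2"
  shows "typing ar (\<Theta>1 \<union> \<Theta>2) (TensorTm M N) (TensorT A B)"
proof -
  from assms obtain \<Gamma>1 \<Delta>1 \<Gamma>2 \<Delta>2 where *: "\<Theta>1 = \<Gamma>1 \<union> \<Delta>1" "\<Theta>2 = \<Gamma>2 \<union> \<Delta>2"
    "exponential \<Gamma>1" "exponential \<Gamma>2" "apart [\<Gamma>1 \<union> \<Gamma>2, \<Delta>1, \<Delta>2]"
    by (meson compat_split typing_is_env)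
  then have "typing ar (\<Gamma>1 \<union> \<Gamma>2 \<union> \<Delta>1 \<union> \<Delta>2) (TensorTm M N) (TensorT A B)"
    using assms by (intro typing.tensor_pair) auto
  moreover have "\<Gamma>1 \<union> \<Gamma>2 \<union> \<Delta>1 \<union> \<Delta>2 = \<Theta>1 \<union> \<Theta>2" using * by blast
  ultimately show ?thesis by simp
qed

section \<open>The left rules as a closure operator, and generation\<close>

text \<open>A left rule has one premise and keeps the term, so a block of left rules in a derivation
  is a path between environments. The closure holds of \<open>\<Theta>\<close> if such a path, read
  upwards from \<open>\<Theta>\<close>, reaches an environment satisfying \<open>P\<close>.\<close>

inductive left_closure :: "(env \<Rightarrow> bool) \<Rightarrow> env \<Rightarrow> bool" for P where
  base: "P \<Theta> \<Longrightarrow> left_closure P \<Theta>"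
| weakening: "left_closure P \<Delta> \<Longrightarrow> apart [{PBang x}, \<Delta>] \<Longrightarrow> left_closure P ({PBang x} \<union> \<Delta>)"
| unit: "left_closure P \<Delta> \<Longrightarrow> left_closure P ({PUnit} \<union> \<Delta>)"
| tensor: "left_closure P ({p} \<union> {q} \<union> \<Delta>) \<Longrightarrow> apart [{p}, {q}, \<Delta>] \<Longrightarrow> left_closure P ({PTensor p q} \<union> \<Delta>)"
| with1: "left_closure P ({p1} \<union> \<Delta>) \<Longrightarrow> linear_pat p2 \<Longrightarrow> apart [{p1}, {p2}, \<Delta>] \<Longrightarrow> left_closure P ({PWith p1 p2} \<union> \<Delta>)"
| with2: "left_closure P ({p2} \<union> \<Delta>) \<Longrightarrow> linear_pat p1 \<Longrightarrow> apart [{p1}, {p2}, \<Delta>] \<Longrightarrow> left_closure P ({PWith p1 p2} \<union> \<Delta>)"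

text \<open>Concatenation of paths; with \<open>left_closure.base\<close> as unit this is the bind
  of a monad.\<close>

lemma left_closure_bind: "left_closure P \<Theta> \<Longrightarrow> (\<And>\<Theta>. P \<Theta> \<Longrightarrow> left_closure Q \<Theta>) \<Longrightarrow> left_closure Q \<Theta>"
  by (induction rule: left_closure.induct) (blast intro: left_closure.intros)+

lemma left_closure_mono: "left_closure P \<Theta> \<Longrightarrow> (\<And>\<Theta>. P \<Theta> \<Longrightarrow> Q \<Theta>) \<Longrightarrow> left_closure Q \<Theta>"
  by (erule left_closure_bind) (auto intro: left_closure.base)

lemma left_closure_ex: "left_closure P \<Theta> \<Longrightarrow> \<exists>\<Theta>. P \<Theta>"
  by (induction rule: left_closure.induct) auto

lemma typing_left_closure: "left_closure (\<lambda>\<Theta>. typing ar \<Theta> M A) \<Theta> \<Longrightarrow> typing ar \<Theta> M A"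
  by (induction rule: left_closure.induct) (blast intro: typing.intros)+

lemma typing_left_closureI: "left_closure P \<Theta> \<Longrightarrow> (\<And>\<Theta>. P \<Theta> \<Longrightarrow> typing ar \<Theta> M A) \<Longrightarrow> typing ar \<Theta> M A"
  by (rule typing_left_closure) (erule left_closure_mono)

text \<open>A pattern decomposed by a tensor or with rule is not exponential, so compatibility makes
  its variables disjoint from those of \<open>\<Psi>\<close> and the rule still applies. Only
  weakening may find its pattern already in \<open>\<Psi>\<close>, and is then skipped.\<close>

lemma left_closure_frame:
  "left_closure P \<Theta> \<Longrightarrow> compat_env \<Theta> \<Psi> \<Longrightarrow> left_closure (\<lambda>X. \<exists>\<Theta>0. P \<Theta>0 \<and> compat_env \<Theta>0 \<Psi> \<and> X = \<Theta>0 \<union> \<Psi>) (\<Theta> \<union> \<Psi>)"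
proof (induction rule: left_closure.induct)
  case (base \<Theta>)
  then show ?case by (auto intro: left_closure.base)
next
  case (weakening \<Delta> x)
  show ?case
  proof (cases "PBang x \<in> \<Psi>")
    case True
    then have "{PBang x} \<union> \<Delta> \<union> \<Psi> = \<Delta> \<union> \<Psi>" by blast
    with weakening show ?thesis by (simp only: compat_Un)
  next
    case False
    with weakening.prems have "x \<notin> evars \<Psi>" by (fastforce simp: compat_env_def evars_def)
    with weakening have "left_closure (\<lambda>X. \<exists>\<Theta>0. P \<Theta>0 \<and> compat_env \<Theta>0 \<Psi> \<and> X = \<Theta>0 \<union> \<Psi>)
        ({PBang x} \<union> (\<Delta> \<union> \<Psi>))"
      by (intro left_closure.weakening) (simp_all only: compat_Un, simp)
    then show ?thesis by (simp only: Un_assoc)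
  qed
next
  case (unit \<Delta>)
  then have "left_closure (\<lambda>X. \<exists>\<Theta>0. P \<Theta>0 \<and> compat_env \<Theta>0 \<Psi> \<and> X = \<Theta>0 \<union> \<Psi>) ({PUnit} \<union> (\<Delta> \<union> \<Psi>))"
    by (intro left_closure.unit) (simp only: compat_Un)
  then show ?case by (simp only: Un_assoc)
next
  case (tensor p q \<Delta>)
  have *: "(set (pvars p) \<union> set (pvars q)) \<inter> evars \<Psi> = {}"
    using tensor.prems by (fastforce simp: compat_env_def evars_def)
  then have "compat_env ({p} \<union> {q} \<union> \<Delta>) \<Psi>" using tensor.prems
    by (auto simp only: compat_Un intro!: compat_disjoint) auto
  from left_closure.tensor[of _ p q "\<Delta> \<union> \<Psi>"] tensor.IH[OF this] * tensor.hyps(2)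
  show ?case by (simp add: Un_assoc Int_Un_distrib Int_Un_distrib2)
next
  case (with1 p1 \<Delta> p2)
  have *: "(set (pvars p1) \<union> set (pvars p2)) \<inter> evars \<Psi> = {}"
    using with1.prems by (fastforce simp: compat_env_def evars_def)
  then have "compat_env ({p1} \<union> \<Delta>) \<Psi>" using with1.prems
    by (auto simp only: compat_Un intro!: compat_disjoint) auto
  from left_closure.with1[of _ p1 "\<Delta> \<union> \<Psi>" p2] with1.IH[OF this] * with1.hyps(2,3)
  show ?case by (simp add: Un_assoc Int_Un_distrib Int_Un_distrib2)
next
  case (with2 p2 \<Delta> p1)
  have *: "(set (pvars p1) \<union> set (pvars p2)) \<inter> evars \<Psi> = {}"
    using with2.prems by (fastforce simp: compat_env_def evars_def)
  then have "compat_env ({p2} \<union> \<Delta>) \<Psi>" using with2.prems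
    by (auto simp only: compat_Un intro!: compat_disjoint) auto
  from left_closure.with2[of _ p2 "\<Delta> \<union> \<Psi>" p1] with2.IH[OF this] * with2.hyps(2,3)
  show ?case by (simp add: Un_assoc Int_Un_distrib Int_Un_distrib2)
qed

lemma left_closure_frame2:
  assumes "left_closure P \<Theta>" "left_closure Q \<Psi>" "compat_env \<Theta> \<Psi>"
  shows "left_closure (\<lambda>X. \<exists>\<Theta> \<Psi>. P \<Theta> \<and> Q \<Psi> \<and> compat_env \<Theta> \<Psi> \<and> X = \<Theta> \<union> \<Psi>) (\<Theta> \<union> \<Psi>)"
proof (rule left_closure_bind[OF left_closure_frame[OF assms(1,3)]], elim exE conjE)
  fix X \<Theta>0 assume 1: "P \<Theta>0" "compat_env \<Theta>0 \<Psi>" "X = \<Theta>0 \<union> \<Psi>"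
  show "left_closure (\<lambda>X. \<exists>\<Theta> \<Psi>. P \<Theta> \<and> Q \<Psi> \<and> compat_env \<Theta> \<Psi> \<and> X = \<Theta> \<union> \<Psi>) X"
    using left_closure_mono[OF left_closure_frame[OF assms(2) compat_sym[OF 1(2)]]] 1
    by (smt (verit) Un_commute compat_sym)
qed

text \<open>The premises of the right rule for each constructor. The rule for abstractions speaks of
  named variables, hence the existence of some named form \<open>lam p M\<close> of the nameless
  term.\<close>

fun right_rule :: "('f \<Rightarrow> nat) \<Rightarrow> env \<Rightarrow> 'f trm \<Rightarrow> ty \<Rightarrow> bool" where
  "right_rule ar \<Delta> (Bang M) A \<longleftrightarrow> exponential \<Delta> \<and> (\<exists>B. A = OfCourse B \<and> typing ar \<Delta> M B)"
| "right_rule ar \<Delta> (Lam s M') A \<longleftrightarrow> (\<exists>p M B. Lam s M' = lam p M \<and> A = Lolli (pty p) B \<and>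
    apart [{p}, \<Delta>] \<and> typing ar ({p} \<union> \<Delta>) M B)"
| "right_rule ar \<Delta> (App M N) B \<longleftrightarrow> (\<exists>A \<Theta>1 \<Theta>2. typing ar \<Theta>1 M (Lolli A B) \<and> typing ar \<Theta>2 N A \<and>
    compat_env \<Theta>1 \<Theta>2 \<and> \<Delta> = \<Theta>1 \<union> \<Theta>2)"
| "right_rule ar \<Delta> UnitTm A \<longleftrightarrow> \<Delta> = {} \<and> A = OneT"
| "right_rule ar \<Delta> (TensorTm M N) C \<longleftrightarrow> (\<exists>A B \<Theta>1 \<Theta>2. C = TensorT A B \<and> typing ar \<Theta>1 M A \<and>
    typing ar \<Theta>2 N B \<and> compat_env \<Theta>1 \<Theta>2 \<and> \<Delta> = \<Theta>1 \<union> \<Theta>2)"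
| "right_rule ar \<Delta> (WithTm M N) C \<longleftrightarrow> (\<exists>A B. C = WithT A B \<and> typing ar \<Delta> M A \<and> typing ar \<Delta> N B)"
| "right_rule ar \<Delta> (Const r) A \<longleftrightarrow> (r = 0 \<or> \<Delta> = {}) \<and> A = RealT"
| "right_rule ar \<Delta> (Fun f) A \<longleftrightarrow> \<Delta> = {} \<and>
    A = Lolli (tensor_pow (OfCourse RealT) (ar f)) (OfCourse RealT)"
| "right_rule ar \<Delta> Add A \<longleftrightarrow> \<Delta> = {} \<and> A = Lolli (WithT RealT RealT) RealT"
| "right_rule ar \<Delta> Mul A \<longleftrightarrow> \<Delta> = {} \<and> A = Lolli RealT (Lolli RealT RealT)"
| "right_rule ar \<Delta> _ A \<longleftrightarrow> True"

text \<open>Generation lemma: as left rules keep the term, the lowest right rule is found by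
  climbing over the left rules below it.\<close>

lemma typing_right_rule: "typing ar \<Delta> M A \<Longrightarrow> left_closure (\<lambda>\<Delta>. right_rule ar \<Delta> M A) \<Delta>"
proof (induction rule: typing.induct)
  case (lam p \<Delta> M B)
  obtain s N where N: "lam p M = Lam s N" by (simp add: lam_def)
  have "right_rule ar \<Delta> (lam p M) (Lolli (pty p) B)"
    unfolding N right_rule.simps unfolding N[symmetric] using lam by blast
  then show ?case by (rule left_closure.base)
next
  case (app \<Gamma>1 \<Delta>1 M A B \<Gamma>2 \<Delta>2 N)
  have "\<Gamma>1 \<union> \<Gamma>2 \<union> \<Delta>1 \<union> \<Delta>2 = (\<Gamma>1 \<union> \<Delta>1) \<union> (\<Gamma>2 \<union> \<Delta>2)" by blast
  then show ?case using app.hyps split_compat[OF app.hyps(3-5)]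
    by (intro left_closure.base) (auto simp del: compat_Un)
next
  case (tensor_pair \<Gamma>1 \<Delta>1 M A \<Gamma>2 \<Delta>2 N B)
  have "\<Gamma>1 \<union> \<Gamma>2 \<union> \<Delta>1 \<union> \<Delta>2 = (\<Gamma>1 \<union> \<Delta>1) \<union> (\<Gamma>2 \<union> \<Delta>2)" by blast
  then show ?case using tensor_pair.hyps split_compat[OF tensor_pair.hyps(3-5)]
    by (intro left_closure.base) (auto simp del: compat_Un)
next
  case (weakening \<Delta> M B x)
  then show ?case by (intro left_closure.weakening)
next
  case (unit_pat \<Delta> M B)
  then show ?case by (intro left_closure.unit)
next
  case (tensor_pat p q \<Delta> M C)
  then show ?case by (intro left_closure.tensor)
next
  case (with_pat1 p1 \<Delta> M B p2)
  then show ?case by (intro left_closure.with1)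
next
  case (with_pat2 p2 \<Delta> M B p1)
  then show ?case by (intro left_closure.with2)
qed (auto intro: left_closure.base)

section \<open>The substitution lemma\<close>

text \<open>The value that \<open>\<tau>\<close> puts in place of a whole pattern. Every value
  matching a linear pattern arises in this way (\<open>pinst_vleaves\<close>), so a substitution for
  patterns can be given by a map on variables.\<close>

fun pinst :: "(var \<Rightarrow> 'f trm) \<Rightarrow> var pat \<Rightarrow> 'f trm" where
  "pinst \<tau> (PVar x) = \<tau> x"
| "pinst \<tau> (PBang x) = Bang (\<tau> x)"
| "pinst \<tau> PUnit = UnitTm"
| "pinst \<tau> (PTensor p q) = TensorTm (pinst \<tau> p) (pinst \<tau> q)"
| "pinst \<tau> (PWith p q) = WithTm (pinst \<tau> p) (pinst \<tau> q)"

lemma pinst_cong: "(\<And>x. x \<in> set (pvars p) \<Longrightarrow> \<tau> x = \<tau>' x) \<Longrightarrow> pinst \<tau> p = pinst \<tau>' p"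
  by (induction p) auto

lemma pinst_vleaves: "vmatch p V \<Longrightarrow> map \<tau> (pvars p) = vleaves p V \<Longrightarrow> pinst \<tau> p = V"
  by (induction p arbitrary: V) (auto simp: append_eq_append_conv length_vleaves)

lemma left_closure_weaken:
  assumes "finite \<Gamma>" "exponential \<Gamma>" "compat_env \<Theta> \<Gamma>" "left_closure P \<Theta>"
  shows "left_closure P (\<Theta> \<union> \<Gamma>)"
  using assms
proof (induction rule: finite_induct)
  case (insert p \<Gamma>)
  then obtain x where p: "p = PBang x" by (auto simp: exponential_def)
  have IH: "left_closure P (\<Theta> \<union> \<Gamma>)" using insert by (auto simp: exponential_def compat_env_def)
  show ?case
  proof (cases "p \<in> \<Theta>")
    case True
    then have "\<Theta> \<union> insert p \<Gamma> = \<Theta> \<union> \<Gamma>" by blast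
    with IH show ?thesis by simp
  next
    case False
    have "x \<notin> evars \<Gamma>" using insert.hyps insert.prems p by (force simp: exponential_def evars_def)
    moreover have "x \<notin> evars \<Theta>" using insert.prems p False by (fastforce simp: compat_env_def evars_def)
    ultimately have "left_closure P ({PBang x} \<union> (\<Theta> \<union> \<Gamma>))" using IH by (intro left_closure.weakening) auto
    then show ?thesis using p by simp
  qed
qed simp

lemma varfree_typing: "pvars p = [] \<Longrightarrow> typing ar {} (pinst \<tau> p) (pty p)"
proof (induction p)
  case (PTensor p q)
  then show ?case using typing_TensorTm[of ar "{}" _ _ "{}"] by simp
qed (auto intro: typing.intros)

text \<open>Such a pattern is built from \<open>PUnit\<close> alone, and its instance from
  \<open>UnitTm\<close>, whose right rule has the empty environment. The components of a
  \<open>PWith\<close> share their environment, so either one suffices.\<close>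

lemma varfree_left_closure: "pvars p = [] \<Longrightarrow> typing ar \<Theta> (pinst \<tau> p) A \<Longrightarrow> left_closure (\<lambda>\<Theta>. \<Theta> = {}) \<Theta>"
proof (induction p arbitrary: A \<Theta>)
  case PUnit
  then show ?case using typing_right_rule[OF PUnit.prems(2)] by (auto elim: left_closure_mono)
next
  case (PTensor p q)
  show ?case
  proof (rule left_closure_bind[OF typing_right_rule[OF PTensor.prems(2)]])
    fix \<Theta>' assume "right_rule ar \<Theta>' (pinst \<tau> (PTensor p q)) A"
    then obtain A B \<Theta>1 \<Theta>2 where *: "typing ar \<Theta>1 (pinst \<tau> p) A" "typing ar \<Theta>2 (pinst \<tau> q) B"
      "compat_env \<Theta>1 \<Theta>2" "\<Theta>' = \<Theta>1 \<union> \<Theta>2" by auto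
    have "left_closure (\<lambda>\<Theta>. \<Theta> = {}) \<Theta>1" "left_closure (\<lambda>\<Theta>. \<Theta> = {}) \<Theta>2"
      using PTensor.IH *(1,2) PTensor.prems(1) by auto
    from left_closure_frame2[OF this *(3)] show "left_closure (\<lambda>\<Theta>. \<Theta> = {}) \<Theta>'"
      unfolding *(4) by (rule left_closure_mono) auto
  qed
next
  case (PWith p q)
  show ?case
  proof (rule left_closure_bind[OF typing_right_rule[OF PWith.prems(2)]])
    fix \<Theta>' assume "right_rule ar \<Theta>' (pinst \<tau> (PWith p q)) A"
    then show "left_closure (\<lambda>\<Theta>. \<Theta> = {}) \<Theta>'" using PWith by auto
  qed
qed auto

text \<open>An environment split can put copies of a pattern \<open>!x\<close> or of a pattern without variables on both
  sides. The last two conjuncts ensure that the environment realizing it can be copied as well.\<close>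

definition realizes :: "('f \<Rightarrow> nat) \<Rightarrow> (var \<Rightarrow> 'f trm) \<Rightarrow> var pat \<Rightarrow> env \<Rightarrow> bool" where
  "realizes ar \<tau> p \<Theta> \<longleftrightarrow> typing ar \<Theta> (pinst \<tau> p) (pty p) \<and>
    (\<forall>x. p = PBang x \<longrightarrow> exponential \<Theta> \<and> typing ar \<Theta> (\<tau> x) (snd x)) \<and>
    (pvars p = [] \<longrightarrow> \<Theta> = {})"

lemma realizes_PBang:
  "realizes ar \<tau> (PBang x) \<Theta> \<Longrightarrow> exponential \<Theta> \<and> typing ar \<Theta> (\<tau> x) (snd x)"
  unfolding realizes_def by blast

lemma realizes_varfree: "realizes ar \<tau> p \<Theta> \<Longrightarrow> pvars p = [] \<Longrightarrow> \<Theta> = {}"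
  unfolding realizes_def by blast

lemma realizes_cong:
  "(\<And>x. x \<in> set (pvars p) \<Longrightarrow> \<tau> x = \<tau>' x) \<Longrightarrow> realizes ar \<tau> p \<Theta> \<Longrightarrow> realizes ar \<tau>' p \<Theta>"
  unfolding realizes_def using pinst_cong[of p \<tau> \<tau>'] by auto

text \<open>Typing alone does not give the last two conjuncts of \<open>realizes\<close>. Climbing
  over left rules does: up to the premise of promotion for \<open>!x\<close>, up to the empty
  environment for a pattern without variables.\<close>

lemma realizes_left_closure: "typing ar \<Theta> (pinst \<tau> p) (pty p) \<Longrightarrow> left_closure (realizes ar \<tau> p) \<Theta>"
proof (cases "pvars p = []")
  case True
  assume "typing ar \<Theta> (pinst \<tau> p) (pty p)"
  from varfree_left_closure[OF True this] show ?thesis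
    by (rule left_closure_mono) (use True varfree_typing[OF True] in \<open>auto simp: realizes_def\<close>)
next
  case False
  assume *: "typing ar \<Theta> (pinst \<tau> p) (pty p)"
  show ?thesis
  proof (cases "\<exists>x. p = PBang x")
    case True
    with typing_right_rule[OF *] show ?thesis
      by (elim left_closure_mono) (auto simp: realizes_def intro: typing.promotion)
  next
    case no_bang: False
    with False * show ?thesis by (intro left_closure.base) (auto simp: realizes_def)
  qed
qed

section \<open>Substitutions for whole environments\<close>

definition realizes_env :: "('f \<Rightarrow> nat) \<Rightarrow> (var \<Rightarrow> 'f trm) \<Rightarrow> env \<Rightarrow> env \<Rightarrow> bool" where
  "realizes_env ar \<tau> \<Delta> \<Theta> \<longleftrightarrow> finite \<Delta> \<and> (\<exists>G. (\<forall>p\<in>\<Delta>. realizes ar \<tau> p (G p)) \<and>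
    (\<forall>p\<in>\<Delta>. \<forall>q\<in>\<Delta>. p \<noteq> q \<longrightarrow> compat_env (G p) (G q)) \<and> \<Theta> = (\<Union>p\<in>\<Delta>. G p))"

lemma realizes_env_empty [simp]: "realizes_env ar \<tau> {} \<Theta> \<longleftrightarrow> \<Theta> = {}"
  by (simp add: realizes_env_def)

text \<open>Disjointness concerns variables only, so \<open>PUnit\<close> and its like can still lie
  in both sets.\<close>

lemma disjoint_varfree: "evars \<Delta> \<inter> evars \<Theta> = {} \<Longrightarrow> p \<in> \<Delta> \<inter> \<Theta> \<Longrightarrow> pvars p = []"
proof -
  assume disj: "evars \<Delta> \<inter> evars \<Theta> = {}" and "p \<in> \<Delta> \<inter> \<Theta>"
  then have "set (pvars p) \<subseteq> evars \<Delta>" "set (pvars p) \<subseteq> evars \<Theta>" by (auto simp: evars_def)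
  with disj have "set (pvars p) = {}" by (metis Int_greatest subset_empty)
  then show ?thesis by simp
qed

lemma realizes_env_single [simp]: "realizes_env ar \<tau> {p} \<Theta> \<longleftrightarrow> realizes ar \<tau> p \<Theta>"
  by (auto simp: realizes_env_def)

lemma realizes_env_cong:
  assumes "realizes_env ar \<tau> \<Delta> \<Theta>" "\<And>x. x \<in> evars \<Delta> \<Longrightarrow> \<tau> x = \<tau>' x"
  shows "realizes_env ar \<tau>' \<Delta> \<Theta>"
proof -
  have "realizes ar \<tau>' p \<Theta>" if "p \<in> \<Delta>" "realizes ar \<tau> p \<Theta>" for p \<Theta>
    by (rule realizes_cong[OF _ that(2)]) (use that assms(2) in \<open>auto simp: evars_def\<close>)
  moreover from assms(1) obtain G where "finite \<Delta>" "\<forall>p\<in>\<Delta>. realizes ar \<tau> p (G p)"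
    "\<forall>p\<in>\<Delta>. \<forall>q\<in>\<Delta>. p \<noteq> q \<longrightarrow> compat_env (G p) (G q)" "\<Theta> = (\<Union>p\<in>\<Delta>. G p)"
    unfolding realizes_env_def by blast
  ultimately show ?thesis unfolding realizes_env_def by (intro conjI exI[of _ G]) auto
qed

text \<open>The critical case is a pattern lying on both sides, whose environment must be compatible
  with itself. It is, being exponential for \<open>!x\<close> and empty for a pattern without
  variables.\<close>

lemma realizes_env_split:
  assumes "realizes_env ar \<tau> (\<Delta>1 \<union> \<Delta>2) \<Theta>" "compat_env \<Delta>1 \<Delta>2"
  obtains \<Theta>1 \<Theta>2 where "realizes_env ar \<tau> \<Delta>1 \<Theta>1" "realizes_env ar \<tau> \<Delta>2 \<Theta>2"
    "compat_env \<Theta>1 \<Theta>2" "\<Theta> = \<Theta>1 \<union> \<Theta>2"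
proof -
  from assms(1) obtain G where fin: "finite (\<Delta>1 \<union> \<Delta>2)"
    and G: "\<forall>p\<in>\<Delta>1 \<union> \<Delta>2. realizes ar \<tau> p (G p)"
    and c: "\<forall>p\<in>\<Delta>1 \<union> \<Delta>2. \<forall>q\<in>\<Delta>1 \<union> \<Delta>2. p \<noteq> q \<longrightarrow> compat_env (G p) (G q)"
    and \<Theta>: "\<Theta> = (\<Union>p\<in>\<Delta>1 \<union> \<Delta>2. G p)" unfolding realizes_env_def by blast
  have "compat_env (G p) (G q)" if "p \<in> \<Delta>1" "q \<in> \<Delta>2" for p q
  proof (cases "p = q")
    case True
    with assms(2) that have "pvars p = [] \<or> (\<exists>x. p = PBang x)" by (fastforce simp: compat_env_def)
    moreover have "realizes ar \<tau> p (G p)" using G that by blast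
    ultimately show ?thesis using True by (metis compat_empty(1) compat_self realizes_PBang realizes_varfree)
  qed (use c that in blast)
  then have "compat_env (\<Union>p\<in>\<Delta>1. G p) (\<Union>p\<in>\<Delta>2. G p)" by (fastforce simp: compat_env_def)
  moreover have "realizes_env ar \<tau> \<Delta>1 (\<Union>p\<in>\<Delta>1. G p)" "realizes_env ar \<tau> \<Delta>2 (\<Union>p\<in>\<Delta>2. G p)"
    using fin G c unfolding realizes_env_def by blast+
  ultimately show thesis using that \<Theta> by simp
qed

lemma realizes_env_Un:
  assumes "realizes_env ar \<tau> \<Delta>1 \<Theta>1" "realizes_env ar \<tau> \<Delta>2 \<Theta>2" "compat_env \<Theta>1 \<Theta>2"
    and vf: "\<forall>p\<in>\<Delta>1 \<inter> \<Delta>2. pvars p = []"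
  shows "realizes_env ar \<tau> (\<Delta>1 \<union> \<Delta>2) (\<Theta>1 \<union> \<Theta>2)"
proof -
  from assms(1) obtain G1 where 1: "finite \<Delta>1" "\<forall>p\<in>\<Delta>1. realizes ar \<tau> p (G1 p)"
    "\<forall>p\<in>\<Delta>1. \<forall>q\<in>\<Delta>1. p \<noteq> q \<longrightarrow> compat_env (G1 p) (G1 q)" "\<Theta>1 = (\<Union>p\<in>\<Delta>1. G1 p)"
    unfolding realizes_env_def by blast
  from assms(2) obtain G2 where 2: "finite \<Delta>2" "\<forall>p\<in>\<Delta>2. realizes ar \<tau> p (G2 p)"
    "\<forall>p\<in>\<Delta>2. \<forall>q\<in>\<Delta>2. p \<noteq> q \<longrightarrow> compat_env (G2 p) (G2 q)" "\<Theta>2 = (\<Union>p\<in>\<Delta>2. G2 p)"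
    unfolding realizes_env_def by blast
  \<comment> \<open>On a shared pattern both choices are the empty environment, so preferring
    \<open>G1\<close> loses nothing.\<close>
  define G where "G p = (if p \<in> \<Delta>1 then G1 p else G2 p)" for p
  have G1: "G p = G1 p" if "p \<in> \<Delta>1" for p using that by (simp add: G_def)
  have G2: "G p = G2 p" if "p \<in> \<Delta>2" for p
    using that vf 1(2) 2(2) by (auto simp: G_def realizes_def)
  have c: "compat_env (G p) (G q)" if "p \<in> \<Delta>1" "q \<in> \<Delta>2" for p q
    using assms(3) that unfolding G1[OF that(1)] G2[OF that(2)] 1(4) 2(4) compat_env_def by blast
  have "\<forall>p\<in>\<Delta>1 \<union> \<Delta>2. \<forall>q\<in>\<Delta>1 \<union> \<Delta>2. p \<noteq> q \<longrightarrow> compat_env (G p) (G q)"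
    using c compat_sym[OF c] 1(3) 2(3) G1 G2 by auto
  moreover have "\<forall>p\<in>\<Delta>1 \<union> \<Delta>2. realizes ar \<tau> p (G p)" using 1(2) 2(2) G1 G2 by auto
  moreover have "\<Theta>1 \<union> \<Theta>2 = (\<Union>p\<in>\<Delta>1 \<union> \<Delta>2. G p)" using 1(4) 2(4) G1 G2 by auto
  ultimately show ?thesis using 1(1) 2(1) unfolding realizes_env_def by blast
qed

lemma left_closure_realizes_env_Un:
  assumes "left_closure (realizes_env ar \<tau> \<Delta>1) \<Theta>1" "left_closure (realizes_env ar \<tau> \<Delta>2) \<Theta>2" "compat_env \<Theta>1 \<Theta>2"
    and "\<forall>p\<in>\<Delta>1 \<inter> \<Delta>2. pvars p = []"
  shows "left_closure (realizes_env ar \<tau> (\<Delta>1 \<union> \<Delta>2)) (\<Theta>1 \<union> \<Theta>2)"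
  using left_closure_frame2[OF assms(1-3)] by (rule left_closure_mono) (use assms(4) in \<open>auto intro: realizes_env_Un\<close>)

lemma realizes_env_is_env: "realizes_env ar \<tau> \<Delta> \<Theta> \<Longrightarrow> is_env \<Theta>"
proof -
  assume "realizes_env ar \<tau> \<Delta> \<Theta>"
  then obtain G where G: "finite \<Delta>" "\<forall>p\<in>\<Delta>. realizes ar \<tau> p (G p)"
    "\<forall>p\<in>\<Delta>. \<forall>q\<in>\<Delta>. p \<noteq> q \<longrightarrow> compat_env (G p) (G q)" "\<Theta> = (\<Union>p\<in>\<Delta>. G p)"
    unfolding realizes_env_def by blast
  then have "is_env (G p)" if "p \<in> \<Delta>" for p using that by (auto simp: realizes_def dest: typing_is_env)
  then have env: "finite (G p)" "\<forall>q\<in>G p. linear_pat q"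
    "\<forall>q\<in>G p. \<forall>r\<in>G p. q \<noteq> r \<longrightarrow> set (pvars q) \<inter> set (pvars r) = {}" if "p \<in> \<Delta>" for p
    using that unfolding is_env_def by blast+
  have "set (pvars q) \<inter> set (pvars r) = {}"
    if "p \<in> \<Delta>" "p' \<in> \<Delta>" "q \<in> G p" "r \<in> G p'" "q \<noteq> r" for p p' q r
  proof (cases "p = p'")
    case True
    with env(3) that show ?thesis by blast
  next
    case False
    with G(3) that have "compat_env (G p) (G p')" by blast
    with that show ?thesis unfolding compat_env_def by blast
  qed
  then show ?thesis unfolding is_env_def G(4) using G(1) env(1,2) by blast
qed

lemma realizes_env_exponential:
  "realizes_env ar \<tau> \<Delta> \<Theta> \<Longrightarrow> exponential \<Delta> \<Longrightarrow> exponential \<Theta>"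
proof -
  assume "realizes_env ar \<tau> \<Delta> \<Theta>" and exp: "exponential \<Delta>"
  then obtain G where G: "\<forall>p\<in>\<Delta>. realizes ar \<tau> p (G p)" "\<Theta> = (\<Union>p\<in>\<Delta>. G p)"
    unfolding realizes_env_def by blast
  have "exponential (G p)" if "p \<in> \<Delta>" for p
  proof -
    from exp that obtain x where "p = PBang x" unfolding exponential_def by blast
    with G(1) that show ?thesis by (metis realizes_PBang)
  qed
  then show ?thesis unfolding G(2) exponential_def by blast
qed

section \<open>The identity substitution and renaming of binders\<close>

text \<open>Identity expansion of the variable axiom. The left tensor rule goes below the pair,
  which has to split the decomposed environment; the left with rules go above it, since each
  component needs its own projection.\<close>

lemma typing_pinst_Free: "linear_pat p \<Longrightarrow> typing ar {p} (pinst Free p) (pty p)"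
proof (induction p)
  case (PVar x)
  then show ?case by (simp add: typing.var)
next
  case (PBang x)
  then show ?case by (auto intro!: typing.promotion typing.bang_var simp: exponential_def)
next
  case PUnit
  then show ?case using typing.unit_pat[OF typing.unit] by simp
next
  case (PTensor p q)
  then have lin: "linear_pat p" "linear_pat q" "set (pvars p) \<inter> set (pvars q) = {}"
    by (auto simp: linear_pat_def)
  with PTensor have "typing ar ({p} \<union> {q}) (pinst Free (PTensor p q)) (pty (PTensor p q))"
    by (simp only: pinst.simps pty.simps) (intro typing_TensorTm compat_disjoint; simp)
  then have "typing ar ({PTensor p q} \<union> {}) (pinst Free (PTensor p q)) (pty (PTensor p q))"
    using lin by (intro typing.tensor_pat) auto
  then show ?case by simp
next
  case (PWith p q)
  then have lin: "linear_pat p" "linear_pat q" "set (pvars p) \<inter> set (pvars q) = {}"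
    by (auto simp: linear_pat_def)
  have "typing ar ({PWith p q} \<union> {}) (pinst Free p) (pty p)"
    "typing ar ({PWith p q} \<union> {}) (pinst Free q) (pty q)"
    using PWith.IH lin by (intro typing.with_pat1 typing.with_pat2; simp)+
  then show ?case by (simp add: typing.with_pair)
qed

lemma pinst_map_pat: "pinst \<tau> (map_pat \<rho> p) = pinst (\<lambda>x. \<tau> (\<rho> x)) p"
  by (induction p) auto

lemma pty_map_pat: "(\<And>x. snd (\<rho> x) = snd x) \<Longrightarrow> pty (map_pat \<rho> p) = pty p"
  by (induction p) auto

text \<open>Holds only up to left rules: \<open>PUnit\<close> lies in \<open>\<Delta>\<close> but
  must be realized by the empty environment.\<close>

lemma left_closure_realizes_env_Free: "is_env \<Delta> \<Longrightarrow> left_closure (realizes_env ar Free \<Delta>) \<Delta>"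
proof -
  assume env: "is_env \<Delta>"
  then have "finite \<Delta>" by (simp add: is_env_def)
  then show ?thesis using env
  proof (induction \<Delta> rule: finite_induct)
    case empty
    show ?case by (intro left_closure.base) simp
  next
    case (insert p \<Delta>)
    have "linear_pat p" and \<Delta>: "is_env \<Delta>" using insert by (auto simp: is_env_def)
    then have "left_closure (realizes_env ar Free {p}) {p}"
      by (intro left_closure_mono[OF realizes_left_closure[OF typing_pinst_Free]]) simp_all
    moreover have "compat_env {p} \<Delta>" using insert by (auto simp: is_env_def compat_env_def)
    ultimately have "left_closure (realizes_env ar Free ({p} \<union> \<Delta>)) ({p} \<union> \<Delta>)"
      using insert \<Delta> by (intro left_closure_realizes_env_Un) auto
    then show ?case by simp
  qed
qed

lemma finite_fv [simp]: "finite (fv M)"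
  by (induction M) auto

lemma finite_evars: "finite \<Delta> \<Longrightarrow> finite (evars \<Delta>)"
  by (simp add: evars_def)

lemma fresh_renaming:
  assumes "finite (X :: var set)"
  shows "\<exists>\<rho> :: var \<Rightarrow> var. inj \<rho> \<and> (\<forall>x. snd (\<rho> x) = snd x) \<and> (\<forall>x. \<rho> x \<notin> X)"
proof -
  \<comment> \<open>Adding \<open>n\<close> to every name is injective and keeps types;
    \<open>insert 0\<close> gives \<open>Max\<close> a meaning for empty \<open>X\<close>.\<close>
  define n where "n = Suc (Max (insert 0 (fst ` X)))"
  let ?\<rho> = "\<lambda>x :: var. (fst x + n, snd x)"
  have "fst x < n" if "x \<in> X" for x
    using that assms unfolding n_def by (intro le_imp_less_Suc Max_ge) auto
  then have "?\<rho> x \<notin> X" for x by force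
  then show ?thesis by (intro exI[of _ ?\<rho>]) (auto simp: inj_def prod_eq_iff)
qed

text \<open>Capture avoidance: \<open>\<rho>\<close> moves the bound variables away from the images
  of the free ones, so binding after the substitution catches the renamed variables only.\<close>

lemma sub_lam:
  assumes lc: "\<And>x. lc 0 (\<tau> x)" and M: "lc 0 M" and p: "linear_pat p"
    and inj: "inj \<rho>" and ty: "\<And>x. snd (\<rho> x) = snd x"
    and fresh: "\<And>x y. y \<in> fv M \<Longrightarrow> \<rho> x \<notin> fv (\<tau> y)"
  shows "sub \<tau> Bound (lam p M) =
    lam (map_pat \<rho> p) (sub (\<lambda>x. if x \<in> set (pvars p) then Free (\<rho> x) else \<tau> x) Bound M)"
proof -
  let ?xs = "pvars p"
  have "map_pat snd (map_pat \<rho> p) = map_pat snd p"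
    by (simp add: pat.map_comp comp_def ty)
  moreover have "sub \<tau> Bound (bind_vars 0 ?xs M) =
    bind_vars 0 (map \<rho> ?xs) (sub (\<lambda>x. if x \<in> set ?xs then Free (\<rho> x) else \<tau> x) Bound M)"
    unfolding bind_vars_conv_sub sub_sub
  proof (rule sub_cong[OF M])
    fix x assume x: "x \<in> fv M"
    show "sub \<tau> Bound (bindmap 0 ?xs x) =
      sub (bindmap 0 (map \<rho> ?xs)) Bound (if x \<in> set ?xs then Free (\<rho> x) else \<tau> x)"
    proof (cases "x \<in> set ?xs")
      case True
      then obtain i where i: "i < length ?xs" "x = ?xs ! i" by (metis in_set_conv_nth)
      have "distinct ?xs" using p by (simp add: linear_pat_def)
      moreover from this have "distinct (map \<rho> ?xs)" using inj_on_subset[OF inj subset_UNIV] by (simp add: distinct_map)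
      moreover from this have "bindmap 0 (map \<rho> ?xs) (map \<rho> ?xs ! i) = (Bound 0 i :: 'a trm)"
        using i by (intro bindmap_nth) simp_all
      ultimately show ?thesis using True i by (simp add: bindmap_nth)
    next
      case False
      have "sub (bindmap 0 (map \<rho> ?xs)) Bound (\<tau> x) = \<tau> x"
        using fresh[OF x] by (intro sub_lc_id lc bindmap_notin) auto
      with False show ?thesis by (simp add: bindmap_notin)
    qed
  qed simp
  ultimately show ?thesis by (simp add: lam_def lc)
qed

text \<open>A right rule that splits its environment splits \<open>\<Theta>\<close> by
  \<open>realizes_env_split\<close>. A left rule that decomposes a pattern is answered by inverting
  the typing of the value put in its place.\<close>

lemma typing_sub:
  assumes "typing ar \<Delta> M A" and "\<And>x. lc 0 (\<tau> x)" and "realizes_env ar \<tau> \<Delta> \<Theta>"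
  shows "typing ar \<Theta> (sub \<tau> Bound M) A"
  using assms
proof (induction arbitrary: \<tau> \<Theta> rule: typing.induct)
  case (var x)
  then show ?case by (simp add: realizes_def)
next
  case (bang_var x)
  then show ?case by (simp add: realizes_def)
next
  case (promotion \<Gamma> M A)
  then show ?case by (auto intro: typing.promotion realizes_env_exponential)
next
  case (weakening \<Delta> M B x)
  from realizes_env_split[OF weakening.prems(2) compat_disjoint] weakening.hyps(2)
  obtain \<Theta>1 \<Theta>2 where *: "realizes_env ar \<tau> {PBang x} \<Theta>1" "realizes_env ar \<tau> \<Delta> \<Theta>2"
    "compat_env \<Theta>1 \<Theta>2" "\<Theta> = \<Theta>1 \<union> \<Theta>2" by auto
  have "exponential \<Theta>1" using *(1) by (simp add: realizes_def)
  moreover have "finite \<Theta>1" using realizes_env_is_env[OF *(1)] by (simp add: is_env_def)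
  moreover have "typing ar \<Theta>2 (sub \<tau> Bound M) B" by (intro weakening.IH weakening.prems *)
  ultimately have "left_closure (\<lambda>\<Theta>. typing ar \<Theta> (sub \<tau> Bound M) B) (\<Theta>2 \<union> \<Theta>1)"
    by (intro left_closure_weaken[OF _ _ compat_sym[OF *(3)] left_closure.base])
  then have "typing ar (\<Theta>2 \<union> \<Theta>1) (sub \<tau> Bound M) B" by (rule typing_left_closure)
  then show ?case using *(4) by (simp add: Un_commute)
next
  case (lam p \<Delta> M B)
  have envs: "is_env \<Theta>" "linear_pat p" "lc 0 M"
    using realizes_env_is_env[OF lam.prems(2)] typing_is_env[OF lam.hyps(1)] typing_lc[OF lam.hyps(1)]
    by (simp_all add: is_env_def)
  \<comment> \<open>Freshness for \<open>\<Theta>\<close> allows the renamed pattern to stand next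
    to it; freshness for the images prevents capture.\<close>
  have "finite (evars \<Theta> \<union> (\<Union>x\<in>fv M. fv (\<tau> x)))"
    using envs(1) by (auto simp: is_env_def finite_evars)
  from fresh_renaming[OF this] obtain \<rho> :: "var \<Rightarrow> var" where "inj \<rho>"
    "\<forall>x. snd (\<rho> x) = snd x" "\<forall>x. \<rho> x \<notin> evars \<Theta> \<union> (\<Union>x\<in>fv M. fv (\<tau> x))" by blast
  note \<rho> = this(1) this(2,3)[rule_format]
  define \<tau>' where "\<tau>' x = (if x \<in> set (pvars p) then Free (\<rho> x) else \<tau> x)" for x
  let ?p = "map_pat \<rho> p"
  have eq: "sub \<tau> Bound (lam p M) = lam ?p (sub \<tau>' Bound M)"
    unfolding \<tau>'_def using \<rho> envs lam.prems(1) by (intro sub_lam) auto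
  have lin: "linear_pat ?p"
    using envs(2) inj_on_subset[OF \<rho>(1) subset_UNIV] by (simp add: linear_pat_def distinct_map)
  have "typing ar {?p} (pinst Free ?p) (pty p)"
    using typing_pinst_Free[OF lin, of ar] \<rho>(2) by (simp add: pty_map_pat)
  moreover have "pinst (Free :: var \<Rightarrow> 'a trm) ?p = pinst \<tau>' p"
    unfolding pinst_map_pat by (rule pinst_cong) (simp add: \<tau>'_def)
  ultimately have 1: "left_closure (realizes_env ar \<tau>' {p}) {?p}"
    by (intro left_closure_mono[OF realizes_left_closure[of ar "{?p}" \<tau>' p]]) simp_all
  have "realizes_env ar \<tau>' \<Delta> \<Theta>"
    by (rule realizes_env_cong[OF lam.prems(2)]) (use lam.hyps(2) in \<open>auto simp: \<tau>'_def\<close>)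
  then have 2: "left_closure (realizes_env ar \<tau>' \<Delta>) \<Theta>" by (rule left_closure.base)
  have ap: "apart [{?p}, \<Theta>]" using \<rho>(3) by auto
  have "left_closure (realizes_env ar \<tau>' ({p} \<union> \<Delta>)) ({?p} \<union> \<Theta>)"
  proof (rule left_closure_realizes_env_Un[OF 1 2])
    show "compat_env {?p} \<Theta>" using ap by (intro compat_disjoint) simp
    show "\<forall>q\<in>{p} \<inter> \<Delta>. pvars q = []" using lam.hyps(2) disjoint_varfree[of "{p}" \<Delta>] by auto
  qed
  then have "typing ar ({?p} \<union> \<Theta>) (sub \<tau>' Bound M) B"
    by (rule typing_left_closureI) (rule lam.IH, simp add: \<tau>'_def lam.prems(1))
  from typing.lam[OF this ap] show ?case unfolding eq by (simp add: pty_map_pat \<rho>(2))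
next
  case (app \<Gamma>1 \<Delta>1 M A B \<Gamma>2 \<Delta>2 N)
  have "\<Gamma>1 \<union> \<Gamma>2 \<union> \<Delta>1 \<union> \<Delta>2 = (\<Gamma>1 \<union> \<Delta>1) \<union> (\<Gamma>2 \<union> \<Delta>2)" by blast
  with app.prems(2) split_compat[OF app.hyps(3-5)] obtain \<Theta>1 \<Theta>2
    where *: "realizes_env ar \<tau> (\<Gamma>1 \<union> \<Delta>1) \<Theta>1" "realizes_env ar \<tau> (\<Gamma>2 \<union> \<Delta>2) \<Theta>2"
      "compat_env \<Theta>1 \<Theta>2" "\<Theta> = \<Theta>1 \<union> \<Theta>2" by (metis realizes_env_split)
  show ?case unfolding *(4) sub.simps
    by (rule typing_App[OF app.IH(1)[OF app.prems(1) *(1)] app.IH(2)[OF app.prems(1) *(2)] *(3)])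
next
  case unit
  then show ?case by (simp add: typing.unit)
next
  case (unit_pat \<Delta> M B)
  from realizes_env_split[OF unit_pat.prems(2) compat_disjoint]
  obtain \<Theta>1 \<Theta>2 where *: "realizes_env ar \<tau> {PUnit} \<Theta>1" "realizes_env ar \<tau> \<Delta> \<Theta>2"
    "compat_env \<Theta>1 \<Theta>2" "\<Theta> = \<Theta>1 \<union> \<Theta>2" by auto
  then have "\<Theta> = \<Theta>2" by (simp add: realizes_def)
  with * unit_pat show ?case by simp
next
  case (tensor_pair \<Gamma>1 \<Delta>1 M A \<Gamma>2 \<Delta>2 N B)
  have "\<Gamma>1 \<union> \<Gamma>2 \<union> \<Delta>1 \<union> \<Delta>2 = (\<Gamma>1 \<union> \<Delta>1) \<union> (\<Gamma>2 \<union> \<Delta>2)" by blast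
  with tensor_pair.prems(2) split_compat[OF tensor_pair.hyps(3-5)] obtain \<Theta>1 \<Theta>2
    where *: "realizes_env ar \<tau> (\<Gamma>1 \<union> \<Delta>1) \<Theta>1" "realizes_env ar \<tau> (\<Gamma>2 \<union> \<Delta>2) \<Theta>2"
      "compat_env \<Theta>1 \<Theta>2" "\<Theta> = \<Theta>1 \<union> \<Theta>2" by (metis realizes_env_split)
  show ?case unfolding *(4) sub.simps
    by (rule typing_TensorTm[OF tensor_pair.IH(1)[OF tensor_pair.prems(1) *(1)] tensor_pair.IH(2)[OF tensor_pair.prems(1) *(2)] *(3)])
next
  case (tensor_pat p q \<Delta> M C)
  have disj: "evars {PTensor p q} \<inter> evars \<Delta> = {}" using tensor_pat.hyps(2) by auto
  from realizes_env_split[OF tensor_pat.prems(2) compat_disjoint[OF disj]]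
  obtain \<Theta>1 \<Theta>2 where *: "realizes ar \<tau> (PTensor p q) \<Theta>1" "realizes_env ar \<tau> \<Delta> \<Theta>2"
    "compat_env \<Theta>1 \<Theta>2" "\<Theta> = \<Theta>1 \<union> \<Theta>2" by auto
  have "typing ar \<Theta>1 (TensorTm (pinst \<tau> p) (pinst \<tau> q)) (TensorT (pty p) (pty q))"
    using *(1) by (simp add: realizes_def)
  \<comment> \<open>The pair may be typed in an environment not yet split; the path of left rules
    leads to one that is.\<close>
  from typing_right_rule[OF this] have "left_closure (realizes_env ar \<tau> ({p} \<union> {q})) \<Theta>1"
  proof (rule left_closure_bind)
    fix \<Theta> assume "right_rule ar \<Theta> (TensorTm (pinst \<tau> p) (pinst \<tau> q)) (TensorT (pty p) (pty q))"
    then obtain \<Theta>1 \<Theta>2 where *: "typing ar \<Theta>1 (pinst \<tau> p) (pty p)" "typing ar \<Theta>2 (pinst \<tau> q) (pty q)"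
      "compat_env \<Theta>1 \<Theta>2" "\<Theta> = \<Theta>1 \<union> \<Theta>2" by auto
    show "left_closure (realizes_env ar \<tau> ({p} \<union> {q})) \<Theta>" unfolding *(4)
    proof (rule left_closure_realizes_env_Un[OF _ _ *(3)])
      show "left_closure (realizes_env ar \<tau> {p}) \<Theta>1" by (rule left_closure_mono[OF realizes_left_closure[OF *(1)]]) simp
      show "left_closure (realizes_env ar \<tau> {q}) \<Theta>2" by (rule left_closure_mono[OF realizes_left_closure[OF *(2)]]) simp
      show "\<forall>r\<in>{p} \<inter> {q}. pvars r = []" using tensor_pat.hyps(2) by auto
    qed
  qed
  moreover have "evars ({p} \<union> {q}) \<inter> evars \<Delta> = {}" using disj by auto
  then have "\<forall>r\<in>({p} \<union> {q}) \<inter> \<Delta>. pvars r = []" by (blast intro: disjoint_varfree)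
  ultimately have "left_closure (realizes_env ar \<tau> ({p} \<union> {q} \<union> \<Delta>)) \<Theta>"
    unfolding *(4) by (intro left_closure_realizes_env_Un *(3) left_closure.base[where P = "realizes_env ar \<tau> \<Delta>", OF *(2)])
  then show ?case by (rule typing_left_closureI) (rule tensor_pat.IH[OF tensor_pat.prems(1)])
next
  case (with_pair \<Delta> M1 A1 M2 A2)
  then show ?case by (auto intro: typing.with_pair)
next
  case (with_pat1 p1 \<Delta> M B p2)
  have disj: "evars {PWith p1 p2} \<inter> evars \<Delta> = {}" using with_pat1.hyps(3) by auto
  from realizes_env_split[OF with_pat1.prems(2) compat_disjoint[OF disj]]
  obtain \<Theta>1 \<Theta>2 where *: "realizes ar \<tau> (PWith p1 p2) \<Theta>1" "realizes_env ar \<tau> \<Delta> \<Theta>2"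
    "compat_env \<Theta>1 \<Theta>2" "\<Theta> = \<Theta>1 \<union> \<Theta>2" by auto
  have "typing ar \<Theta>1 (WithTm (pinst \<tau> p1) (pinst \<tau> p2)) (WithT (pty p1) (pty p2))"
    using *(1) by (simp add: realizes_def)
  \<comment> \<open>Both components are typed in the same environment, so the component not selected
    is simply dropped.\<close>
  from typing_right_rule[OF this] have "left_closure (realizes_env ar \<tau> {p1}) \<Theta>1"
    by (rule left_closure_bind) (auto intro: left_closure_mono[OF realizes_left_closure])
  moreover have "evars ({p1}) \<inter> evars \<Delta> = {}" using disj by auto
  then have "\<forall>r\<in>({p1}) \<inter> \<Delta>. pvars r = []" by (blast intro: disjoint_varfree)
  ultimately have "left_closure (realizes_env ar \<tau> ({p1} \<union> \<Delta>)) \<Theta>"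
    unfolding *(4) by (intro left_closure_realizes_env_Un *(3) left_closure.base[where P = "realizes_env ar \<tau> \<Delta>", OF *(2)])
  then show ?case by (rule typing_left_closureI) (rule with_pat1.IH[OF with_pat1.prems(1)])
next
  case (with_pat2 p2 \<Delta> M B p1)
  have disj: "evars {PWith p1 p2} \<inter> evars \<Delta> = {}" using with_pat2.hyps(3) by auto
  from realizes_env_split[OF with_pat2.prems(2) compat_disjoint[OF disj]]
  obtain \<Theta>1 \<Theta>2 where *: "realizes ar \<tau> (PWith p1 p2) \<Theta>1" "realizes_env ar \<tau> \<Delta> \<Theta>2"
    "compat_env \<Theta>1 \<Theta>2" "\<Theta> = \<Theta>1 \<union> \<Theta>2" by auto
  have "typing ar \<Theta>1 (WithTm (pinst \<tau> p1) (pinst \<tau> p2)) (WithT (pty p1) (pty p2))"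
    using *(1) by (simp add: realizes_def)
  from typing_right_rule[OF this] have "left_closure (realizes_env ar \<tau> {p2}) \<Theta>1"
    by (rule left_closure_bind) (auto intro: left_closure_mono[OF realizes_left_closure])
  moreover have "evars ({p2}) \<inter> evars \<Delta> = {}" using disj by auto
  then have "\<forall>r\<in>({p2}) \<inter> \<Delta>. pvars r = []" by (blast intro: disjoint_varfree)
  ultimately have "left_closure (realizes_env ar \<tau> ({p2} \<union> \<Delta>)) \<Theta>"
    unfolding *(4) by (intro left_closure_realizes_env_Un *(3) left_closure.base[where P = "realizes_env ar \<tau> \<Delta>", OF *(2)])
  then show ?case by (rule typing_left_closureI) (rule with_pat2.IH[OF with_pat2.prems(1)])
qed (auto intro: typing.intros realizes_env_is_env)

section \<open>Typed steps as untyped steps\<close>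

definition vsub :: "var list \<Rightarrow> 'f trm list \<Rightarrow> var \<Rightarrow> 'f trm" where
  "vsub xs vs x = (case map_of (zip xs vs) x of None \<Rightarrow> Free x | Some N \<Rightarrow> N)"

lemma vsub_map: "distinct xs \<Longrightarrow> length xs = length vs \<Longrightarrow> map (vsub xs vs) xs = vs"
  by (auto simp: vsub_def map_of_zip_nth intro!: nth_equalityI)

lemma vsub_notin: "x \<notin> set xs \<Longrightarrow> vsub xs vs x = Free x"
proof -
  assume "x \<notin> set xs"
  then have "x \<notin> dom (map_of (zip xs vs))" by (auto simp: dom_map_of_conv_image_fst dest: set_zip_leftD)
  then show ?thesis by (simp add: vsub_def domIff)
qed

lemma vsub_in: "x \<in> set xs \<Longrightarrow> length xs = length vs \<Longrightarrow> vsub xs vs x \<in> set vs"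
proof -
  assume "x \<in> set xs" "length xs = length vs"
  then obtain N where "map_of (zip xs vs) x = Some N" by (metis map_of_zip_is_Some)
  then show ?thesis by (auto simp: vsub_def dest!: map_of_SomeD set_zip_rightD)
qed

lemma vsub_append: "length xs = length vs \<Longrightarrow> distinct (xs @ ys) \<Longrightarrow>
    vsub (xs @ ys) (vs @ ws) x = (if x \<in> set xs then vsub xs vs x else vsub ys ws x)"
proof -
  assume len: "length xs = length vs" and "distinct (xs @ ys)"
  have dom: "dom (map_of (zip xs vs)) = set xs" using len by simp
  show ?thesis
  proof (cases "x \<in> set xs")
    case True
    then obtain N where N: "map_of (zip xs vs) x = Some N" using len by (metis map_of_zip_is_Some)
    have "x \<notin> set ys" using True \<open>distinct (xs @ ys)\<close> by auto
    then have "x \<notin> dom (map_of (zip ys ws))"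
      by (auto simp: dom_map_of_conv_image_fst dest: set_zip_leftD)
    then show ?thesis using len N True by (simp add: vsub_def map_add_def domIff)
  next
    case False
    with dom have "map_of (zip xs vs) x = None" by blast
    with False len show ?thesis
      by (auto simp: vsub_def map_add_def simp del: map_of_zip_is_None split: option.split)
  qed
qed

lemma vleaves_lc_fv: "lc 0 V \<Longrightarrow> N \<in> set (vleaves p V) \<Longrightarrow> lc 0 N \<and> fv N \<subseteq> fv V"
  by (induction p V rule: vleaves.induct) auto

lemma vsub_vleaves_lc:
  "vmatch p V \<Longrightarrow> lc 0 V \<Longrightarrow> lc 0 (vsub (pvars p) (vleaves p V) x)"
  using vsub_in[of x "pvars p" "vleaves p V"] vsub_notin[of x "pvars p" "vleaves p V"] vleaves_lc_fv[of V _ p]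
  by (cases "x \<in> set (pvars p)") (auto simp: length_vleaves)

text \<open>The leaves of \<open>V\<close> contain no variable of \<open>q\<close>, so the second
  substitution leaves them alone and the sequence acts simultaneously.\<close>

lemma psubst_pair:
  assumes V: "vmatch p V" "vmatch q W" "lc 0 V" "lc 0 W"
    and disj: "distinct (pvars p @ pvars q)" "set (pvars q) \<inter> fv V = {}"
    and IH: "psubst p V M = sub (vsub (pvars p) (vleaves p V)) Bound M"
      "\<And>M. psubst q W M = sub (vsub (pvars q) (vleaves q W)) Bound M"
  shows "psubst q W (psubst p V M) =
    sub (vsub (pvars p @ pvars q) (vleaves p V @ vleaves q W)) Bound M"
proof -
  have "sub (vsub (pvars q) (vleaves q W)) Bound (vsub (pvars p) (vleaves p V) x) =
    vsub (pvars p @ pvars q) (vleaves p V @ vleaves q W) x" for x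
  proof (cases "x \<in> set (pvars p)")
    case True
    let ?N = "vsub (pvars p) (vleaves p V) x"
    have "?N \<in> set (vleaves p V)" using vsub_in[OF True] V length_vleaves by metis
    then have "lc 0 ?N" "fv ?N \<subseteq> fv V" using vleaves_lc_fv V by blast+
    then have "sub (vsub (pvars q) (vleaves q W)) Bound ?N = ?N"
      using disj by (intro sub_lc_id vsub_notin) auto
    with True show ?thesis using V disj by (simp add: vsub_append length_vleaves)
  next
    case False
    then show ?thesis using V disj by (simp add: vsub_append length_vleaves vsub_notin)
  qed
  then show ?thesis by (simp add: IH sub_sub)
qed

lemma psubst_conv_sub:
  "vmatch p V \<Longrightarrow> lc 0 V \<Longrightarrow> distinct (pvars p) \<Longrightarrow> set (pvars p) \<inter> fv V = {} \<Longrightarrow>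
   psubst p V M = sub (vsub (pvars p) (vleaves p V)) Bound M"
proof (induction p arbitrary: V M)
  case (PVar x)
  have eq: "vsub [x] [V] = Free(x := V)" by (auto simp: vsub_def)
  show ?case unfolding psubst.simps pvars.simps vleaves.simps eq
    using PVar.prems(2) by (rule subst_conv_sub)
next
  case (PBang x)
  then obtain N where N: "V = Bang N" by auto
  have eq: "vsub [x] [N] = Free(x := N)" by (auto simp: vsub_def)
  show ?case unfolding N psubst.simps pvars.simps vleaves.simps eq
    using PBang.prems(2) N by (intro subst_conv_sub) simp
next
  case PUnit
  then have V: "V = UnitTm" by simp
  have eq: "vsub [] [] = Free" by (auto simp: vsub_def)
  show ?case unfolding V psubst.simps pvars.simps vleaves.simps eq by simp
next
  case (PTensor p q)
  then obtain V1 V2 where V: "V = TensorTm V1 V2" "vmatch p V1" "vmatch q V2" by auto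
  have "psubst q V2 (psubst p V1 M) =
    sub (vsub (pvars p @ pvars q) (vleaves p V1 @ vleaves q V2)) Bound M"
    using V PTensor.prems by (intro psubst_pair PTensor.IH) auto
  with V show ?case by simp
next
  case (PWith p q)
  then obtain V1 V2 where V: "V = WithTm V1 V2" "vmatch p V1" "vmatch q V2" by auto
  have "psubst q V2 (psubst p V1 M) =
    sub (vsub (pvars p @ pvars q) (vleaves p V1 @ vleaves q V2)) Bound M"
    using V PWith.prems by (intro psubst_pair PWith.IH) auto
  with V show ?case by simp
qed

lemma psubst_conv_inst:
  assumes "vmatch p V" "lc 0 V" "lc 0 M" "linear_pat p" "set (pvars p) \<inter> fv V = {}"
  shows "psubst p V M = inst (vleaves p V) (bind_vars 0 (pvars p) M)"
  using assms
  by (subst inst_bind_vars[where \<tau> = "vsub (pvars p) (vleaves p V)"])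
    (auto simp: psubst_conv_sub linear_pat_def vsub_map length_vleaves vsub_notin)

lemma is_value_vmatch: "is_value ar p V \<Longrightarrow> vmatch p V"
  by (induction p arbitrary: V) auto

text \<open>The types that \<open>is_value\<close> demands at variables come from generation,
  component by component.\<close>

lemma vmatch_is_value: "vmatch p V \<Longrightarrow> typing ar \<Theta> V (pty p) \<Longrightarrow> is_value ar p V"
proof (induction p arbitrary: V \<Theta>)
  case (PTensor p q)
  then show ?case using left_closure_ex[OF typing_right_rule[OF PTensor.prems(2)]] by fastforce
next
  case (PWith p q)
  then show ?case using left_closure_ex[OF typing_right_rule[OF PWith.prems(2)]] by fastforce
qed auto

lemma step_ustep: "step ar den M M' \<Longrightarrow> ustep ar den M M'"
proof (induction rule: step.induct)
  case (beta p M V)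
  then have "psubst p V M = inst (vleaves p V) (bind_vars 0 (pvars p) M)"
    by (intro psubst_conv_inst) (auto dest: is_value_vmatch is_term_lc)
  then show ?case using beta by (auto simp: lam_def is_value_vmatch intro!: ustep.root)
next
  case (func rs f)
  then show ?case by (auto simp flip: const_tuple_def intro!: ustep.root)
next
  case (lam p M M')
  then show ?case by (auto simp: lam_def bind_vars_conv_sub intro: ustep.lam ustep_sub)
qed (auto intro: ustep.intros)

section \<open>Binding variables creates no redex\<close>

lemma bind_vars_const_tuple: "bind_vars k xs N = const_tuple rs \<Longrightarrow> N = const_tuple rs"
proof (induction rs arbitrary: N rule: induct_list012)
  case 1
  then show ?case by (cases N) (auto split: option.splits)
next
  case (2 r)
  then show ?case
  proof (cases N)
    case (Bang N')
    with 2 show ?thesis by (cases N') (auto split: option.splits)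
  qed (auto split: option.splits)
next
  case (3 r s rs)
  then show ?case
  proof (cases N)
    case (TensorTm N1 N2)
    with 3 have "bind_vars k xs N1 = Bang (Const r)" "N2 = const_tuple (s # rs)" by auto
    moreover from this(1) obtain N1' where "N1 = Bang N1'" "bind_vars k xs N1' = Const r"
      by (cases N1) (auto split: option.splits)
    moreover from this(2) have "N1' = Const r" by (cases N1') (auto split: option.splits)
    ultimately show ?thesis using TensorTm by simp
  qed (auto split: option.splits)
qed

lemma bind_vars_Const [simp]: "bind_vars k xs N = Const r \<longleftrightarrow> N = Const r"
  by (cases N) (auto split: option.splits)

lemma vmatch_bind_vars: "vmatch s (bind_vars k xs N) \<Longrightarrow> vmatch s N"
proof (induction s arbitrary: N)
  case (PBang x)
  then show ?case by (cases N) (auto split: option.splits)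
next
  case PUnit
  then show ?case by (cases N) (auto split: option.splits)
next
  case (PTensor s t)
  then show ?case by (cases N) (auto split: option.splits)
next
  case (PWith s t)
  then show ?case by (cases N) (auto split: option.splits)
qed auto

text \<open>Binding only turns names into indices, and the shapes that \<open>contract\<close>
  inspects contain neither.\<close>

lemma contract_bind_vars:
  assumes "contract ar den (bind_vars k xs M) (bind_vars k xs N) = Some R"
  obtains R' where "contract ar den M N = Some R'" "R = bind_vars k xs R'"
proof -
  have "\<exists>R'. contract ar den M N = Some R'"
    using assms
  proof (cases rule: contract_cases)
    case (beta s B)
    then obtain B' where "M = Lam s B'" by (cases M) (auto split: option.splits)
    with beta show ?thesis by (auto dest: vmatch_bind_vars)
  next
    case (func f rs)
    then have "M = Fun f" by (cases M) (auto split: option.splits)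
    with func show ?thesis by (auto dest: bind_vars_const_tuple)
  next
    case (add a b)
    then have "M = Add" by (cases M) (auto split: option.splits)
    moreover from add have "N = WithTm (Const a) (Const b)" by (cases N) (auto split: option.splits)
    ultimately show ?thesis by simp
  next
    case (mul a b)
    then obtain M1 where "M = App M1 (Const a)" "bind_vars k xs M1 = Mul"
      by (cases M) (auto split: option.splits)
    moreover from this(2) have "M1 = Mul" by (cases M1) (auto split: option.splits)
    ultimately show ?thesis using mul by simp
  qed
  \<comment> \<open>\<open>contract\<close> is a function, so its stability under substitution
    determines the result.\<close>
  then obtain R' where R': "contract ar den M N = Some R'" ..
  with contract_sub[OF R'] assms have "R = bind_vars k xs R'" by (simp add: bind_vars_conv_sub)
  with R' show thesis by (rule that)
qed

text \<open>Used to descend under a binder in subject reduction, where a reduct of the nameless body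
  must be brought back to the form \<open>lam p M1\<close>.\<close>

lemma ustep_bind_vars:
  assumes "ustep ar den (bind_vars k xs M) N"
  shows "\<exists>M'. N = bind_vars k xs M' \<and> ustep ar den M M'"
  using assms
proof (induction M arbitrary: k N)
  case (Free x)
  then show ?case by (cases "map_of (zip xs [0..<length xs]) x") (auto elim: ustep.cases)
next
  case (Bang M)
  from Bang.prems obtain M' where "N = Bang M'" "ustep ar den (bind_vars k xs M) M'"
    by (auto elim: ustep_BangE)
  with Bang.IH show ?case by (metis bind_vars.simps(3) ustep.bang)
next
  case (Lam s M)
  from Lam.prems obtain M' where "N = Lam s M'" "ustep ar den (bind_vars (Suc k) xs M) M'"
    by (auto elim: ustep_LamE)
  with Lam.IH show ?case by (metis bind_vars.simps(4) ustep.lam)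
next
  case (App M1 M2)
  from App.prems show ?case unfolding bind_vars.simps
  proof (cases rule: ustep_AppE)
    case root
    then obtain R where "contract ar den M1 M2 = Some R" "N = bind_vars k xs R" by (rule contract_bind_vars)
    then show ?thesis by (blast intro: ustep.root)
  next
    case (left M')
    with App.IH(1) show ?thesis by (metis bind_vars.simps(5) ustep.appL)
  next
    case (right M')
    with App.IH(2) show ?thesis by (metis bind_vars.simps(5) ustep.appR)
  qed
next
  case (TensorTm M1 M2)
  from TensorTm.prems show ?case unfolding bind_vars.simps
  proof (cases rule: ustep_TensorTmE)
    case (left M')
    with TensorTm.IH(1) show ?thesis by (metis bind_vars.simps(7) ustep.tensorL)
  next
    case (right M')
    with TensorTm.IH(2) show ?thesis by (metis bind_vars.simps(7) ustep.tensorR)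
  qed
next
  case (WithTm M1 M2)
  from WithTm.prems show ?case unfolding bind_vars.simps
  proof (cases rule: ustep_WithTmE)
    case (left M')
    with WithTm.IH(1) show ?thesis by (metis bind_vars.simps(9) ustep.withL)
  next
    case (right M')
    with WithTm.IH(2) show ?thesis by (metis bind_vars.simps(9) ustep.withR)
  qed
qed (auto elim: ustep.cases)

section \<open>Subject reduction\<close>

text \<open>\<open>step.beta\<close> wants bound variables that avoid the value, while the
  derivation may have chosen others. Renaming is the substitution lemma for a map from variables to
  variables.\<close>

lemma lam_fresh:
  assumes "typing ar ({p} \<union> \<Delta>) M B" "apart [{p}, \<Delta>]" "finite X"
  obtains p' M' where "lam p' M' = lam p M" "pty p' = pty p" "apart [{p'}, \<Delta>]"
    "typing ar ({p'} \<union> \<Delta>) M' B" "set (pvars p') \<inter> X = {}"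
proof -
  have env: "is_env \<Delta>" "linear_pat p" "lc 0 M"
    using typing_is_env[OF assms(1)] typing_lc[OF assms(1)] by (simp_all add: is_env_def)
  then have "finite (X \<union> evars \<Delta> \<union> fv M)" using assms(3) by (simp add: finite_evars is_env_def)
  from fresh_renaming[OF this] obtain \<rho> :: "var \<Rightarrow> var" where "inj \<rho>"
    "\<forall>x. snd (\<rho> x) = snd x" "\<forall>x. \<rho> x \<notin> X \<union> evars \<Delta> \<union> fv M" by blast
  note \<rho> = this(1) this(2,3)[rule_format]
  let ?p = "map_pat \<rho> p"
  define \<tau> :: "var \<Rightarrow> 'a trm" where "\<tau> x = (if x \<in> set (pvars p) then Free (\<rho> x) else Free x)" for x
  have lc: "lc 0 (\<tau> x)" for x by (simp add: \<tau>_def)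
  have "sub Free Bound (lam p M) = lam ?p (sub \<tau> Bound M)"
    unfolding \<tau>_def
  proof (rule sub_lam[OF _ env(3,2) \<rho>(1,2)])
    show "\<rho> x \<notin> fv (Free y)" if "y \<in> fv M" for x y
      using \<rho>(3)[of x] that by (metis UnCI fv.simps(1) singletonD)
  qed simp
  then have eq: "lam ?p (sub \<tau> Bound M) = lam p M" by simp
  have lin: "linear_pat ?p"
    using env(2) inj_on_subset[OF \<rho>(1) subset_UNIV] by (simp add: linear_pat_def distinct_map)
  have ty: "pty ?p = pty p" using \<rho>(2) by (rule pty_map_pat)
  have "pinst (Free :: var \<Rightarrow> 'a trm) ?p = pinst \<tau> p"
    unfolding pinst_map_pat by (rule pinst_cong) (simp add: \<tau>_def)
  with typing_pinst_Free[OF lin, of ar] ty have "typing ar {?p} (pinst \<tau> p) (pty p)" by simp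
  then have 1: "left_closure (realizes_env ar \<tau> {p}) {?p}"
    by (intro left_closure_mono[OF realizes_left_closure[of ar "{?p}" \<tau> p]]) simp_all
  have 2: "left_closure (realizes_env ar \<tau> \<Delta>) \<Delta>"
    using left_closure_realizes_env_Free[OF env(1)]
    by (rule left_closure_mono) (erule realizes_env_cong, use assms(2) in \<open>auto simp: \<tau>_def\<close>)
  have ap: "apart [{?p}, \<Delta>]" using \<rho>(3) by auto
  have "left_closure (realizes_env ar \<tau> ({p} \<union> \<Delta>)) ({?p} \<union> \<Delta>)"
    using ap assms(2) disjoint_varfree[of "{p}" \<Delta>]
    by (intro left_closure_realizes_env_Un[OF 1 2] compat_disjoint) auto
  then have "typing ar ({?p} \<union> \<Delta>) (sub \<tau> Bound M) B"
    by (rule typing_left_closureI) (rule typing_sub[OF assms(1) lc])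
  moreover have "set (pvars ?p) \<inter> X = {}" using \<rho>(3) by auto
  ultimately show thesis using that eq ty ap by blast
qed

text \<open>The substitution is the value on \<open>p\<close> and the identity on
  \<open>\<Delta>\<close>; each part is realized up to left rules.\<close>

lemma typing_inst:
  assumes M: "typing ar ({p} \<union> \<Delta>) M B" "apart [{p}, \<Delta>]"
    and V: "typing ar \<Theta> V (pty p)" "vmatch p V" and "compat_env \<Delta> \<Theta>"
  shows "typing ar (\<Delta> \<union> \<Theta>) (inst (vleaves p V) (bind_vars 0 (pvars p) M)) B"
proof -
  have env: "is_env \<Delta>" "linear_pat p" "lc 0 M"
    using typing_is_env[OF M(1)] typing_lc[OF M(1)] by (simp_all add: is_env_def)
  let ?\<tau> = "vsub (pvars p) (vleaves p V)"
  have map: "map ?\<tau> (pvars p) = vleaves p V"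
    using env(2) V(2) by (simp add: linear_pat_def vsub_map length_vleaves)
  then have "pinst ?\<tau> p = V" using V(2) by (intro pinst_vleaves)
  then have 1: "left_closure (realizes_env ar ?\<tau> {p}) \<Theta>"
    using V(1) by (intro left_closure_mono[OF realizes_left_closure[of ar \<Theta> ?\<tau> p]]) simp_all
  have 2: "left_closure (realizes_env ar ?\<tau> \<Delta>) \<Delta>"
    using left_closure_realizes_env_Free[OF env(1)]
  proof (rule left_closure_mono)
    fix \<Psi> assume "realizes_env ar Free \<Delta> \<Psi>"
    then show "realizes_env ar ?\<tau> \<Delta> \<Psi>"
    proof (rule realizes_env_cong)
      fix x assume "x \<in> evars \<Delta>"
      then have "x \<notin> set (pvars p)" using M(2) by auto
      then show "Free x = ?\<tau> x" by (simp add: vsub_notin)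
    qed
  qed
  have "left_closure (realizes_env ar ?\<tau> ({p} \<union> \<Delta>)) (\<Theta> \<union> \<Delta>)"
    using M(2) disjoint_varfree[of "{p}" \<Delta>]
    by (intro left_closure_realizes_env_Un[OF 1 2] compat_sym[OF assms(5)]) auto
  then have "typing ar (\<Theta> \<union> \<Delta>) (sub ?\<tau> Bound M) B"
    by (rule typing_left_closureI) (rule typing_sub[OF M(1) vsub_vleaves_lc[OF V(2) typing_lc[OF V(1)]]])
  moreover have "inst (vleaves p V) (bind_vars 0 (pvars p) M) = sub ?\<tau> Bound M"
    using env map by (intro inst_bind_vars) (auto simp: linear_pat_def vsub_notin)
  ultimately show ?thesis by (simp add: Un_commute)
qed

lemma lam_eq_LamD: "lam p M = Lam s B \<Longrightarrow> s = map_pat snd p \<and> B = bind_vars 0 (pvars p) M"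
  by (auto simp: lam_def)

text \<open>The typing of the abstraction may end in left rules; \<open>left_closure_frame\<close>
  climbs over them beside the environment of the argument.\<close>

lemma typing_beta:
  assumes F: "typing ar \<Theta>1 (Lam s B) (Lolli A C)" and V: "typing ar \<Theta>2 V A"
    and c: "compat_env \<Theta>1 \<Theta>2" and m: "vmatch s V"
  shows "typing ar (\<Theta>1 \<union> \<Theta>2) (inst (vleaves s V) B) C"
proof (rule typing_left_closureI[OF left_closure_frame[OF typing_right_rule[OF F] c]], elim exE conjE)
  fix \<Theta> \<Theta>0 assume r: "right_rule ar \<Theta>0 (Lam s B) (Lolli A C)" and c0: "compat_env \<Theta>0 \<Theta>2" "\<Theta> = \<Theta>0 \<union> \<Theta>2"
  then obtain p M where p: "Lam s B = lam p M" "A = pty p" "apart [{p}, \<Theta>0]" "typing ar ({p} \<union> \<Theta>0) M C"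
    by auto
  from lam_eq_LamD[OF p(1)[symmetric]] have s: "s = map_pat snd p" "B = bind_vars 0 (pvars p) M" by auto
  show "typing ar \<Theta> (inst (vleaves s V) B) C"
    using typing_inst[OF p(4,3) _ _ c0(1), of V] V m p(2) c0(2) s by simp
qed

lemma step_beta:
  assumes F: "typing ar \<Theta>1 (Lam s B) (Lolli A C)" and V: "typing ar \<Theta>2 V A" and m: "vmatch s V"
  shows "step ar den (App (Lam s B) V) (inst (vleaves s V) B)"
proof -
  from left_closure_ex[OF typing_right_rule[OF F]] obtain p0 M0 \<Delta> where p0: "Lam s B = lam p0 M0" "A = pty p0"
    "apart [{p0}, \<Delta>]" "typing ar ({p0} \<union> \<Delta>) M0 C" by auto
  from lam_fresh[OF p0(4,3) finite_fv[of V]] obtain p M where p: "lam p M = lam p0 M0" "pty p = pty p0"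
    "typing ar ({p} \<union> \<Delta>) M C" "set (pvars p) \<inter> fv V = {}" by metis
  from lam_eq_LamD[of p M s B] p(1) p0(1)
  have s: "s = map_pat snd p" "B = bind_vars 0 (pvars p) M" by auto
  have lin: "linear_pat p" using typing_is_env[OF p(3)] by (simp add: is_env_def)
  have val: "is_value ar p V" using vmatch_is_value[of p V ar \<Theta>2] V m p(2) p0(2) s(1) by simp
  have "psubst p V M = inst (vleaves s V) B"
    using psubst_conv_inst[of p V M] m s lin p(4) typing_lc[OF V] typing_lc[OF p(3)] by simp
  with step.beta[OF lin typing_is_term[OF p(3)] typing_is_term[OF V] p(4) val, of den] p(1) p0(1)
  show ?thesis by simp
qed

section \<open>Environments of constants and of the contracted redexes\<close>

lemma typing_Const_nonzero: "typing ar \<Theta> (Const r) A \<Longrightarrow> r \<noteq> 0 \<Longrightarrow> left_closure (\<lambda>\<Theta>. \<Theta> = {}) \<Theta>"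
  using left_closure_mono[OF typing_right_rule] by fastforce

lemma typing_Const_left_closure: "left_closure (\<lambda>\<Theta>. \<Theta> = {}) \<Theta> \<Longrightarrow> typing ar \<Theta> (Const r) RealT"
  by (erule typing_left_closureI) (simp add: typing.const)

lemma left_closure_empty_Un:
  "left_closure (\<lambda>\<Theta>. \<Theta> = {}) \<Theta> \<Longrightarrow> compat_env \<Theta> \<Psi> \<Longrightarrow> left_closure P \<Psi> \<Longrightarrow> left_closure P (\<Theta> \<union> \<Psi>)"
  by (rule left_closure_bind[OF left_closure_frame[of "\<lambda>\<Theta>. \<Theta> = {}"]]) auto

lemma typing_empty_Un:
  assumes "left_closure (\<lambda>\<Theta>. \<Theta> = {}) \<Theta>" "compat_env \<Theta> \<Psi>" "typing ar \<Psi> M A"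
  shows "typing ar (\<Theta> \<union> \<Psi>) M A"
  by (rule typing_left_closure, rule left_closure_empty_Un[OF assms(1,2)], rule left_closure.base, rule assms(3))

text \<open>Both summands share \<open>\<Theta>\<close>. If one of them is nonzero,
  \<open>\<Theta>\<close> reduces to the empty environment and every constant is typable; otherwise
  the sum is 0.\<close>

lemma typing_add:
  assumes "typing ar \<Theta> (WithTm (Const a) (Const b)) A"
  shows "typing ar \<Theta> (Const (a + b)) RealT"
  using typing_right_rule[OF assms]
proof (rule typing_left_closureI)
  fix \<Theta> assume "right_rule ar \<Theta> (WithTm (Const a) (Const b)) A"
  then obtain A1 A2 where *: "typing ar \<Theta> (Const a) A1" "typing ar \<Theta> (Const b) A2" by auto
  show "typing ar \<Theta> (Const (a + b)) RealT"
  proof (cases "a = 0 \<and> b = 0")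
    case True
    with * show ?thesis by (auto intro: typing.zero typing_is_env)
  next
    case False
    with * have "left_closure (\<lambda>\<Theta>. \<Theta> = {}) \<Theta>" by (auto dest: typing_Const_nonzero)
    then show ?thesis by (rule typing_Const_left_closure)
  qed
qed

text \<open>A zero factor may hold arbitrary resources, and the product 0 absorbs them. If neither
  factor is zero, both environments reduce to the empty one.\<close>

lemma typing_mult:
  assumes a: "typing ar \<Theta>1 (Const a) A" and b: "typing ar \<Theta>2 (Const b) B" and c: "compat_env \<Theta>1 \<Theta>2"
  shows "typing ar (\<Theta>1 \<union> \<Theta>2) (Const (a * b)) RealT"
proof (cases "a * b = 0")
  case True
  then show ?thesis using typing.zero[OF is_env_Un[OF typing_is_env[OF a] typing_is_env[OF b] c], of ar] by (simp only:)
next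
  case False
  then show ?thesis using a b c by (intro typing_Const_left_closure left_closure_empty_Un) (auto dest: typing_Const_nonzero)
qed

lemma left_closure_exponential: "is_env \<Gamma> \<Longrightarrow> exponential \<Gamma> \<Longrightarrow> left_closure (\<lambda>\<Theta>. \<Theta> = {}) \<Gamma>"
  using left_closure_weaken[of \<Gamma> "{}" "\<lambda>\<Theta>. \<Theta> = {}"] by (auto simp: is_env_def intro: left_closure.base)

text \<open>Promotion requires an exponential environment, and that can be weakened away
  entirely.\<close>

lemma typing_Bang_left_closure: "typing ar \<Theta> (Bang M) A \<Longrightarrow> left_closure (\<lambda>\<Theta>. \<Theta> = {}) \<Theta>"
  by (drule typing_right_rule, erule left_closure_bind) (auto intro: left_closure_exponential typing_is_env)

lemma typing_const_tuple_left_closure: "typing ar \<Theta> (const_tuple rs) A \<Longrightarrow> left_closure (\<lambda>\<Theta>. \<Theta> = {}) \<Theta>"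
proof (induction rs arbitrary: \<Theta> A rule: induct_list012)
  case 1
  then show ?case using left_closure_mono[OF typing_right_rule[OF 1]] by simp
next
  case (2 r)
  then show ?case by (simp add: typing_Bang_left_closure)
next
  case (3 r s rs)
  show ?case using typing_right_rule[OF 3(3)]
  proof (rule left_closure_bind)
    fix \<Theta>' assume "right_rule ar \<Theta>' (const_tuple (r # s # rs)) A"
    then obtain A1 A2 \<Theta>1 \<Theta>2 where *: "typing ar \<Theta>1 (Bang (Const r)) A1"
      "typing ar \<Theta>2 (const_tuple (s # rs)) A2" "compat_env \<Theta>1 \<Theta>2" "\<Theta>' = \<Theta>1 \<union> \<Theta>2"
      by auto
    show "left_closure (\<lambda>\<Theta>. \<Theta> = {}) \<Theta>'"
      unfolding *(4) by (rule left_closure_empty_Un[OF typing_Bang_left_closure[OF *(1)] *(3) 3(2)[OF *(2)]])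
  qed
qed

lemma typing_contract:
  assumes F: "typing ar \<Theta>1 F (Lolli A C)" and V: "typing ar \<Theta>2 V A" and c: "compat_env \<Theta>1 \<Theta>2"
    and "contract ar den F V = Some R"
  shows "step ar den (App F V) R \<and> typing ar (\<Theta>1 \<union> \<Theta>2) R C"
  using assms(4)
proof (cases rule: contract_cases)
  case (beta s B)
  then show ?thesis using typing_beta step_beta F V c by metis
next
  case (func f rs)
  have C: "C = OfCourse RealT" using left_closure_ex[OF typing_right_rule[OF F]] func by auto
  have 1: "left_closure (\<lambda>\<Theta>. \<Theta> = {}) \<Theta>1" using left_closure_mono[OF typing_right_rule[OF F]] func by simp
  have 2: "left_closure (\<lambda>\<Theta>. \<Theta> = {}) \<Theta>2" using V func typing_const_tuple_left_closure by blast
  have "typing ar (\<Theta>1 \<union> \<Theta>2) (Bang (Const (den f rs))) (OfCourse RealT)"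
    using left_closure_empty_Un[OF 1 c 2]
    by (rule typing_left_closureI) (auto intro: typing.promotion typing.const simp: exponential_def)
  then show ?thesis using func C step.func[of rs ar f den] by (simp add: const_tuple_def)
next
  case (add a b)
  have C: "C = RealT" using left_closure_ex[OF typing_right_rule[OF F]] add by auto
  have 1: "left_closure (\<lambda>\<Theta>. \<Theta> = {}) \<Theta>1" using left_closure_mono[OF typing_right_rule[OF F]] add by simp
  have "typing ar \<Theta>2 (Const (a + b)) RealT" using V add typing_add by blast
  from typing_empty_Un[OF 1 c this] have "typing ar (\<Theta>1 \<union> \<Theta>2) (Const (a + b)) RealT" .
  then show ?thesis using add C by (simp add: step.add)
next
  case (mul a b)
  have "typing ar (\<Theta>1 \<union> \<Theta>2) R C"
  proof (rule typing_left_closureI[OF left_closure_frame[OF typing_right_rule[OF F] c]], elim exE conjE)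
    fix \<Theta> \<Theta>0 assume "right_rule ar \<Theta>0 F (Lolli A C)" and c0: "compat_env \<Theta>0 \<Theta>2" "\<Theta> = \<Theta>0 \<union> \<Theta>2"
    \<comment> \<open>Arguments are taken one at a time, so the environment of \<open>F\<close> is
      itself split between \<open>Mul\<close> and the first factor.\<close>
    then obtain A' \<Psi>1 \<Psi>2 where *: "typing ar \<Psi>1 Mul (Lolli A' (Lolli A C))" "typing ar \<Psi>2 (Const a) A'"
      "compat_env \<Psi>1 \<Psi>2" "\<Theta>0 = \<Psi>1 \<union> \<Psi>2" unfolding mul by auto
    have C: "C = RealT" using left_closure_ex[OF typing_right_rule[OF *(1)]] by auto
    have 1: "left_closure (\<lambda>\<Theta>. \<Theta> = {}) \<Psi>1" using left_closure_mono[OF typing_right_rule[OF *(1)]] by simp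
    have "typing ar (\<Psi>2 \<union> \<Theta>2) R C"
      using typing_mult[OF *(2) V[unfolded mul]] c0 * C mul by simp
    moreover have "compat_env \<Psi>1 (\<Psi>2 \<union> \<Theta>2)" using * c0 by simp
    ultimately have "typing ar (\<Psi>1 \<union> (\<Psi>2 \<union> \<Theta>2)) R C" by (intro typing_empty_Un[OF 1])
    then show "typing ar \<Theta> R C" unfolding c0(2) *(4) by (simp only: Un_assoc)
  qed
  then show ?thesis using mul by (simp add: step.mul)
qed

text \<open>Induction on the derivation makes left rules immediate, as they keep the term. That the
  step belongs to the calculus is proved along with preservation, because the type of a contracted
  value is read off the derivation.\<close>

lemma subject_reduction:
  assumes "typing ar \<Delta> M A" and "ustep ar den M M'"
  shows "step ar den M M' \<and> typing ar \<Delta> M' A"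
  using assms
proof (induction arbitrary: M' rule: typing.induct)
  case (promotion \<Gamma> M A)
  then show ?case by (auto elim!: ustep_BangE intro: typing.promotion step.bang)
next
  case (lam p \<Delta> M B)
  from lam.prems obtain N where N: "M' = Lam (map_pat snd p) N" "ustep ar den (bind_vars 0 (pvars p) M) N"
    unfolding lam_def by (auto elim: ustep_LamE)
  from ustep_bind_vars[OF N(2)] obtain M1 where M1: "N = bind_vars 0 (pvars p) M1" "ustep ar den M M1" by blast
  then have eq: "M' = lam p M1" using N(1) by (simp add: lam_def)
  have "linear_pat p" using typing_is_env[OF lam.hyps(1)] by (simp add: is_env_def)
  with lam.IH[OF M1(2)] lam.hyps(2) show ?case unfolding eq by (auto intro: typing.lam step.lam)
next
  case (app \<Gamma>1 \<Delta>1 M A B \<Gamma>2 \<Delta>2 N)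
  note tm = typing_is_term[OF app.hyps(1)] typing_is_term[OF app.hyps(2)]
  from app.prems show ?case
  proof (cases rule: ustep_AppE)
    case root
    have "\<Gamma>1 \<union> \<Gamma>2 \<union> \<Delta>1 \<union> \<Delta>2 = (\<Gamma>1 \<union> \<Delta>1) \<union> (\<Gamma>2 \<union> \<Delta>2)" by blast
    then show ?thesis
      using typing_contract[OF app.hyps(1,2) split_compat[OF app.hyps(3-5)] root] by simp
  next
    case (left M1)
    with app.IH(1)[OF left(2)] app.hyps tm show ?thesis by (blast intro: typing.app step.appL)
  next
    case (right N1)
    with app.IH(2)[OF right(2)] app.hyps tm show ?thesis by (blast intro: typing.app step.appR)
  qed
next
  case (tensor_pair \<Gamma>1 \<Delta>1 M A \<Gamma>2 \<Delta>2 N B)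
  note tm = typing_is_term[OF tensor_pair.hyps(1)] typing_is_term[OF tensor_pair.hyps(2)]
  from tensor_pair.prems show ?case
  proof (cases rule: ustep_TensorTmE)
    case (left M1)
    with tensor_pair.IH(1)[OF left(2)] tensor_pair.hyps tm show ?thesis
      by (blast intro: typing.tensor_pair step.tensorL)
  next
    case (right N1)
    with tensor_pair.IH(2)[OF right(2)] tensor_pair.hyps tm show ?thesis
      by (blast intro: typing.tensor_pair step.tensorR)
  qed
next
  case (with_pair \<Delta> M1 A1 M2 A2)
  note tm = typing_is_term[OF with_pair.hyps(1)] typing_is_term[OF with_pair.hyps(2)]
  from with_pair.prems show ?case
  proof (cases rule: ustep_WithTmE)
    case (left N1)
    with with_pair.IH(1)[OF left(2)] with_pair.hyps tm show ?thesis
      by (blast intro: typing.with_pair step.withL)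
  next
    case (right N1)
    with with_pair.IH(2)[OF right(2)] with_pair.hyps tm show ?thesis
      by (blast intro: typing.with_pair step.withR)
  qed
next
  case (weakening \<Delta> M B x)
  then show ?case by (blast intro: typing.weakening)
next
  case (unit_pat \<Delta> M B)
  then show ?case by (blast intro: typing.unit_pat)
next
  case (tensor_pat p q \<Delta> M C)
  then show ?case by (blast intro: typing.tensor_pat)
next
  case (with_pat1 p1 \<Delta> M B p2)
  then show ?case by (blast intro: typing.with_pat1)
next
  case (with_pat2 p2 \<Delta> M B p1)
  then show ?case by (blast intro: typing.with_pat2)
qed (auto elim: ustep.cases)

lemma usteps_steps:
  assumes "(ustep ar den)\<^sup>*\<^sup>* M N" and "well_typed ar M"
  shows "(step ar den)\<^sup>*\<^sup>* M N \<and> well_typed ar N"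
  using assms
proof (induction rule: rtranclp_induct)
  case (step N N')
  then show ?case unfolding well_typed_def
    by (meson subject_reduction rtranclp.rtrancl_into_rtrancl)
qed simp

theorem theorem3p3:
  fixes ar :: "'f \<Rightarrow> nat" and den :: "'f \<Rightarrow> real list \<Rightarrow> real"
    and M M' M'' :: "'f trm"
  assumes "signature ar den"
    and "well_typed ar M" and "well_typed ar M'" and "well_typed ar M''"
    and "(step ar den)\<^sup>*\<^sup>* M M'" and "(step ar den)\<^sup>*\<^sup>* M M''"
  shows "\<exists>N. well_typed ar N \<and> (step ar den)\<^sup>*\<^sup>* M' N \<and> (step ar den)\<^sup>*\<^sup>* M'' N"
proof -
  have "(ustep ar den)\<^sup>*\<^sup>* M M'" "(ustep ar den)\<^sup>*\<^sup>* M M''"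
    using assms(5,6) step_ustep by (metis mono_rtranclp)+
  \<comment> \<open>The common reduct is found among raw terms; subject reduction along both paths
    brings it back into the calculus.\<close>
  from ustep_confluent[OF this] obtain N where "(ustep ar den)\<^sup>*\<^sup>* M' N" "(ustep ar den)\<^sup>*\<^sup>* M'' N"
    by blast
  with assms(3,4) show ?thesis by (blast dest: usteps_steps)
qed

end
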